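(* Let $m\in\mathbb Z^+$ and $\mathcal D_{2m}=\{(z,w)\in\mathbb C^2:|z|^2+|w|^{2m}<1\}$. The space of holomorphic functions on $\overline{\mathcal D}_{2m}$ (i.e. functions holomorphic in a neighbourhood of $\overline{\mathcal D}_{2m}$) is dense in the Fefferman--Hardy space $\mathrm H^2_{\mathrm F}(\partial\mathcal D_{2m})$.
   Context: Put $\rho(z,w)=|z|^2+|w|^{2m}-1$ and let $\sigma_{\mathrm E}$ be the Euclidean surface measure on $\partial\mathcal D_{2m}$. The Fefferman surface area measure is $d\sigma_{\mathrm F}=\varpi_{\mathrm F}\,d\sigma_{\mathrm E}$ with $$\varpi_{\mathrm F}=\frac1{|d\rho|}\left|\det\begin{pmatrix}\rho&\partial_{\bar j}\rho\\ \partial_i\rho&\partial_i\partial_{\bar j}\rho\end{pmatrix}_{1\le i,j\le 2}\right|^{\frac13},\qquad |d\rho|=\big(|\partial_z\rho|^2+|\partial_w\rho|^2\big)^{1/2},$$ i.e. $\varpi_{\mathrm F}(z,w)=\dfrac{(m^2|w|^{2m-2})^{1/3}}{\sqrt{|z|^2+m^2|w|^{4m-2}}}$ on $\partial\mathcal D_{2m}$. For $\xi\in\partial\mathcal D_{2m}$ let $\nu_\xi$ be the outward unit normal and let $\delta_\xi(z)$ be the minimum of the Euclidean distances from $z$ to $\partial\mathcal D_{2m}$ and to the tangent plane of $\partial\mathcal D_{2m}$ at $\xi$. For $\alpha>0$ let $\Gamma_\alpha(\xi)=\{z\in\mathcal D_{2m}:|(\xi-z)\cdot\overline{\nu_\xi}|<(1+\alpha)\delta_\xi(z),\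 |\xi-z|^2<\alpha\delta_\xi(z)\}$, where $\cdot$ is the complex bilinear dot product, and let $\mathcal N(f)(\xi)=\sup_{z\in\Gamma_\alpha(\xi)}|f(z)|$. The Fefferman--Hardy space $\mathrm H^2_{\mathrm F}(\partial\mathcal D_{2m})$ is the set of holomorphic $f$ on $\mathcal D_{2m}$ with $\mathcal N(f)\in L^2(\partial\mathcal D_{2m},\sigma_{\mathrm F})$. Each such $f$ has a non-tangential boundary value $f^*$ (limit within $\Gamma_\alpha(\xi)$ for all $\alpha>0$) $\sigma_{\mathrm F}$-a.e., and the space is a reproducing kernel Hilbert space with the norm $\|f\|=\big(\int_{\partial\mathcal D_{2m}}|f^*|^2d\sigma_{\mathrm F}\big)^{1/2}$. *)

theory Defs
  imports "HOL-Analysis.Analysis"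
begin

type_synonym c2 = "complex \<times> complex"

definition rho :: "nat \<Rightarrow> c2 \<Rightarrow> real" where
  "rho m p = (cmod (fst p))\<^sup>2 + (cmod (snd p)) ^ (2 * m) - 1"

definition dom2m :: "nat \<Rightarrow> c2 set" where
  "dom2m m = {(z, w). (cmod z)\<^sup>2 + (cmod w) ^ (2 * m) < 1}"

text \<open>Complex differentiability at every point; meant for open sets only.\<close>

definition holomorphic2_on :: "(c2 \<Rightarrow> complex) \<Rightarrow> c2 set \<Rightarrow> bool"
    (infixl \<open>holomorphic2'_on\<close> 50) where
  "f holomorphic2_on U \<longleftrightarrow>
     (\<forall>p\<in>U. \<exists>a b. (f has_derivative (\<lambda>(h, k). a * h + b * k)) (at p))"

definition holomorphic_near :: "c2 set \<Rightarrow> (c2 \<Rightarrow> complex) set" where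
  "holomorphic_near K = {g. \<exists>U. open U \<and> K \<subseteq> U \<and> g holomorphic2_on U}"

definition dir_deriv :: "(c2 \<Rightarrow> complex) \<Rightarrow> c2 \<Rightarrow> c2 \<Rightarrow> complex" where
  "dir_deriv u v p = vector_derivative (\<lambda>t::real. u (p + t *\<^sub>R v)) (at 0)"

definition d_z :: "(c2 \<Rightarrow> complex) \<Rightarrow> c2 \<Rightarrow> complex" where
  "d_z u p = (dir_deriv u (1, 0) p - \<i> * dir_deriv u (\<i>, 0) p) / 2"

definition d_w :: "(c2 \<Rightarrow> complex) \<Rightarrow> c2 \<Rightarrow> complex" where
  "d_w u p = (dir_deriv u (0, 1) p - \<i> * dir_deriv u (0, \<i>) p) / 2"

definition d_zbar :: "(c2 \<Rightarrow> complex) \<Rightarrow> c2 \<Rightarrow> complex" where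
  "d_zbar u p = (dir_deriv u (1, 0) p + \<i> * dir_deriv u (\<i>, 0) p) / 2"

definition d_wbar :: "(c2 \<Rightarrow> complex) \<Rightarrow> c2 \<Rightarrow> complex" where
  "d_wbar u p = (dir_deriv u (0, 1) p + \<i> * dir_deriv u (0, \<i>) p) / 2"

text \<open>
  Euclidean surface measure on a smooth hypersurface of real dimension \<open>n\<close> is the
  \<open>n\<close>-dimensional Hausdorff measure (\<open>n \<ge> 1\<close>), normalised to agree with Lebesgue measure
  on \<open>n\<close>-dimensional planes.  The covering sets are required to be bounded because
  \<^const>\<open>diameter\<close> is unspecified on unbounded sets.
\<close>

definition hausdorff_pre :: "nat \<Rightarrow> real \<Rightarrow> 'a::metric_space set \<Rightarrow> ennreal" where
  "hausdorff_pre n d A =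
     (INF U \<in> {U :: nat \<Rightarrow> 'a set. A \<subseteq> (\<Union>i. U i) \<and> (\<forall>i. bounded (U i) \<and> diameter (U i) \<le> d)}.
        \<Sum>i. ennreal (unit_ball_vol (real n) * (diameter (U i) / 2) ^ n))"

definition hausdorff_outer :: "nat \<Rightarrow> 'a::metric_space set \<Rightarrow> ennreal" where
  "hausdorff_outer n A = (SUP d \<in> {0<..}. hausdorff_pre n d A)"

definition hausdorff_measure :: "nat \<Rightarrow> 'a::metric_space measure" where
  "hausdorff_measure n = measure_of UNIV (sets borel) (hausdorff_outer n)"

definition sigma_E :: "nat \<Rightarrow> c2 measure" where
  "sigma_E m = restrict_space (hausdorff_measure 3) (frontier (dom2m m))"

definition d_rho_norm :: "nat \<Rightarrow> c2 \<Rightarrow> real" where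
  "d_rho_norm m p =
     (let r = (\<lambda>q. complex_of_real (rho m q))
      in sqrt ((cmod (d_z r p))\<^sup>2 + (cmod (d_w r p))\<^sup>2))"

definition fefferman_matrix :: "nat \<Rightarrow> c2 \<Rightarrow> complex ^ 3 ^ 3" where
  "fefferman_matrix m p =
     (let r = (\<lambda>q. complex_of_real (rho m q))
      in vector [vector [r p,     d_zbar r p,         d_wbar r p],
                 vector [d_z r p, d_z (d_zbar r) p,   d_z (d_wbar r) p],
                 vector [d_w r p, d_w (d_zbar r) p,   d_w (d_wbar r) p]])"

definition fefferman_density :: "nat \<Rightarrow> c2 \<Rightarrow> real" where
  "fefferman_density m p = 1 / d_rho_norm m p * root 3 (cmod (det (fefferman_matrix m p)))"

definition sigma_F :: "nat \<Rightarrow> c2 measure" where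
  "sigma_F m = density (sigma_E m) (\<lambda>\<xi>. ennreal (fefferman_density m \<xi>))"

text \<open>
  Under the identification of \<open>\<complex>\<^sup>2\<close> with \<open>\<real>\<^sup>4\<close>, the real gradient of \<open>\<rho>\<close> is
  \<open>2 (\<partial>\<rho>/\<partial>zbar, \<partial>\<rho>/\<partial>wbar)\<close>; it does not vanish on the boundary and points outward,
  as \<open>\<rho> < 0\<close> inside.
\<close>

definition outward_normal :: "nat \<Rightarrow> c2 \<Rightarrow> c2" where
  "outward_normal m \<xi> =
     (let r = (\<lambda>q. complex_of_real (rho m q)) in sgn (d_zbar r \<xi>, d_wbar r \<xi>))"

text \<open>The inner product on \<^typ>\<open>c2\<close> is the real one, so this is the real tangent hyperplane.\<close>

definition tangent_plane :: "nat \<Rightarrow> c2 \<Rightarrow> c2 set" where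
  "tangent_plane m \<xi> = {x. (x - \<xi>) \<bullet> outward_normal m \<xi> = 0}"

definition delta :: "nat \<Rightarrow> c2 \<Rightarrow> c2 \<Rightarrow> real" where
  "delta m \<xi> p = min (infdist p (frontier (dom2m m))) (infdist p (tangent_plane m \<xi>))"

definition cdot :: "c2 \<Rightarrow> c2 \<Rightarrow> complex" where
  "cdot u v = fst u * fst v + snd u * snd v"

definition cnj2 :: "c2 \<Rightarrow> c2" where
  "cnj2 u = (cnj (fst u), cnj (snd u))"

definition approach_region :: "nat \<Rightarrow> real \<Rightarrow> c2 \<Rightarrow> c2 set" where
  "approach_region m \<alpha> \<xi> =
     {p \<in> dom2m m. cmod (cdot (\<xi> - p) (cnj2 (outward_normal m \<xi>))) < (1 + \<alpha>) * delta m \<xi> p \<and>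
                   (norm (\<xi> - p))\<^sup>2 < \<alpha> * delta m \<xi> p}"

definition nt_maximal :: "nat \<Rightarrow> real \<Rightarrow> (c2 \<Rightarrow> complex) \<Rightarrow> c2 \<Rightarrow> ennreal" where
  "nt_maximal m \<alpha> f \<xi> = (SUP p \<in> approach_region m \<alpha> \<xi>. ennreal (cmod (f p)))"

text \<open>
  Elements are represented by total functions of which only the values on the domain matter.
\<close>

definition fefferman_hardy :: "nat \<Rightarrow> real \<Rightarrow> (c2 \<Rightarrow> complex) set" where
  "fefferman_hardy m \<alpha> =
     {f. f holomorphic2_on dom2m m \<and>
         nt_maximal m \<alpha> f \<in> borel_measurable (sigma_F m) \<and>
         (\<integral>\<^sup>+ \<xi>. (nt_maximal m \<alpha> f \<xi>)\<^sup>2 \<partial>sigma_F m) < \<infinity>}"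

definition has_nt_limit :: "nat \<Rightarrow> (c2 \<Rightarrow> complex) \<Rightarrow> complex \<Rightarrow> c2 \<Rightarrow> bool" where
  "has_nt_limit m f l \<xi> \<longleftrightarrow> (\<forall>\<alpha>>0. (f \<longlongrightarrow> l) (at \<xi> within approach_region m \<alpha> \<xi>))"

text \<open>
  For members of the Fefferman--Hardy space the limit exists almost everywhere, so the
  value \<open>0\<close> on the exceptional set does not affect the norm.
\<close>

definition boundary_value :: "nat \<Rightarrow> (c2 \<Rightarrow> complex) \<Rightarrow> c2 \<Rightarrow> complex" where
  "boundary_value m f \<xi> =
     (if \<exists>l. has_nt_limit m f l \<xi> then THE l. has_nt_limit m f l \<xi> else 0)"

definition fh_norm :: "nat \<Rightarrow> (c2 \<Rightarrow> complex) \<Rightarrow> real" where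
  "fh_norm m f = sqrt (\<integral>\<xi>. (cmod (boundary_value m f \<xi>))\<^sup>2 \<partial>sigma_F m)"

lemma dir_deriv_rho:
  "dir_deriv (\<lambda>q. complex_of_real (rho m q)) (a, b) (z, w) =
     of_real (2 * (z \<bullet> a) + 2 * real m * (cmod w) ^ (2 * m - 2) * (w \<bullet> b))"
proof -
  have sq: "rho m (x, y) = x \<bullet> x + (y \<bullet> y) ^ m - 1" for x y
    by (simp add: rho_def power_mult power2_norm_eq_inner)
  have p: "(cmod w) ^ (2 * m - 2) = (w \<bullet> w) ^ (m - 1)"
    by (metis power2_norm_eq_inner power_mult right_diff_distrib' mult_2_right one_add_one mult.right_neutral)
  have "((\<lambda>t. rho m ((z, w) + t *\<^sub>R (a, b))) has_real_derivative
          (2 * (z \<bullet> a) + 2 * real m * (cmod w) ^ (2 * m - 2) * (w \<bullet> b))) (at 0)"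
    unfolding p
    by (simp add: sq inner_add_left inner_add_right inner_commute)
       (auto intro!: derivative_eq_intros simp: inner_commute)
  from has_vector_derivative_of_real[OF this]
  show ?thesis unfolding dir_deriv_def by (rule vector_derivative_at)
qed

lemma d_zbar_rho: "d_zbar (\<lambda>q. complex_of_real (rho m q)) = fst"
  by (rule ext) (auto simp: d_zbar_def dir_deriv_rho inner_complex_def complex_eq_iff)

lemma d_z_rho: "d_z (\<lambda>q. complex_of_real (rho m q)) = (\<lambda>p. cnj (fst p))"
  by (rule ext) (auto simp: d_z_def dir_deriv_rho inner_complex_def complex_eq_iff)

lemma d_wbar_rho:
  "d_wbar (\<lambda>q. complex_of_real (rho m q)) =
     (\<lambda>p. of_real (real m * (cmod (snd p)) ^ (2 * m - 2)) * snd p)"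
  by (rule ext) (auto simp: d_wbar_def dir_deriv_rho inner_complex_def complex_eq_iff)

lemma d_w_rho:
  "d_w (\<lambda>q. complex_of_real (rho m q)) =
     (\<lambda>p. of_real (real m * (cmod (snd p)) ^ (2 * m - 2)) * cnj (snd p))"
  by (rule ext) (auto simp: d_w_def dir_deriv_rho inner_complex_def complex_eq_iff)

lemma dir_deriv_fst: "dir_deriv fst (a, b) p = a"
proof -
  have "((\<lambda>t::real. fst (p + t *\<^sub>R (a, b))) has_vector_derivative a) (at 0)"
    by (auto intro!: derivative_eq_intros)
  then show ?thesis unfolding dir_deriv_def by (rule vector_derivative_at)
qed

lemma dir_deriv_d_wbar_rho:
  "dir_deriv (\<lambda>p. of_real (real m * (cmod (snd p)) ^ (2 * m - 2)) * snd p) (a, b) (z, w) =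
     of_real (real m * (cmod w) ^ (2 * m - 2)) * b +
     of_real (real m * (2 * real (m - 1) * (cmod w) ^ (2 * (m - 1 - 1)) * (w \<bullet> b))) * w"
proof -
  have p: "(cmod x) ^ (2 * m - 2) = (x \<bullet> x) ^ (m - 1)" for x
    by (metis power2_norm_eq_inner power_mult right_diff_distrib' mult_2_right one_add_one mult.right_neutral)
  have p2: "(cmod w) ^ (2 * (m - 1 - 1)) = (w \<bullet> w) ^ (m - 1 - 1)"
    by (simp only: power_mult power2_norm_eq_inner)
  have A: "((\<lambda>t. real m * ((w + t *\<^sub>R b) \<bullet> (w + t *\<^sub>R b)) ^ (m - 1)) has_real_derivative
          (real m * (2 * real (m - 1) * (cmod w) ^ (2 * (m - 1 - 1)) * (w \<bullet> b)))) (at 0)"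
    unfolding p2
    by (simp add: inner_add_left inner_add_right inner_commute)
       (auto intro!: derivative_eq_intros simp: inner_commute)
  have B: "((\<lambda>t::real. w + t *\<^sub>R b) has_vector_derivative b) (at 0)"
    by (auto intro!: derivative_eq_intros)
  show ?thesis
    using has_vector_derivative_mult[OF has_vector_derivative_of_real[OF A] B]
    unfolding dir_deriv_def p by (intro vector_derivative_at) (simp add: p)
qed

lemma fefferman_density_closed_form:
  assumes "m > 0" and "rho m (z, w) = 0"
  shows "fefferman_density m (z, w) =
           root 3 ((real m)\<^sup>2 * (cmod w) ^ (2 * m - 2)) /
           sqrt ((cmod z)\<^sup>2 + (real m)\<^sup>2 * (cmod w) ^ (4 * m - 2))"
proof -
  define c where "c = real m * (cmod w) ^ (2 * m - 2)"
  define r where "r = (\<lambda>q. complex_of_real (rho m q))"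
  have zz: "d_z (d_zbar r) (z, w) = 1" and wz: "d_w (d_zbar r) (z, w) = 0"
    by (simp_all add: r_def d_zbar_rho d_z_def d_w_def dir_deriv_fst)
  have zw: "d_z (d_wbar r) (z, w) = 0"
    unfolding r_def d_wbar_rho d_z_def dir_deriv_d_wbar_rho by simp
  have ww: "d_w (d_wbar r) (z, w) = of_real (real m * c)"
  proof (cases "m = 1")
    case True
    then show ?thesis
      unfolding r_def d_wbar_rho d_w_def dir_deriv_d_wbar_rho by (simp add: c_def)
  next
    case False
    with assms(1) obtain k where k: "m = Suc (Suc k)"
      by (metis One_nat_def gr0_implies_Suc neq0_conv)
    have aux: "(of_real c * 1 + of_real (real m * (E * (w \<bullet> 1))) * w
        - \<i> * (of_real c * \<i> + of_real (real m * (E * (w \<bullet> \<i>))) * w)) / 2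
        = of_real (c + real m * E / 2 * (cmod w)\<^sup>2)" for E
      by (simp add: complex_eq_iff inner_complex_def cmod_power2)
         (simp add: field_simps power2_eq_square)
    have "d_w (d_wbar r) (z, w) =
        of_real (c + real m * (2 * real (m - 1) * (cmod w) ^ (2 * (m - 1 - 1))) / 2 * (cmod w)\<^sup>2)"
      unfolding r_def d_wbar_rho d_w_def dir_deriv_d_wbar_rho
      by (fold c_def) (rule aux)
    also have "c + real m * (2 * real (m - 1) * (cmod w) ^ (2 * (m - 1 - 1))) / 2 * (cmod w)\<^sup>2
        = real m * c"
      by (simp add: c_def k field_simps power2_eq_square)
    finally show ?thesis .
  qed
  have cw: "c * (cmod w)\<^sup>2 = real m * (cmod w) ^ (2 * m)"
    using assms(1) by (cases m) (simp_all add: c_def power2_eq_square)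
  have cw2: "c\<^sup>2 * (cmod w)\<^sup>2 = (real m)\<^sup>2 * (cmod w) ^ (4 * m - 2)"
  proof -
    have "4 * m - 2 = (2 * m - 2) * 2 + 2" using assms(1) by simp
    then show ?thesis by (simp add: c_def power_mult_distrib power_add power_mult power2_eq_square)
  qed
  have one: "(cmod z)\<^sup>2 + (cmod w) ^ (2 * m) = 1"
    using assms(2) by (simp add: rho_def)
  have "det (fefferman_matrix m (z, w)) =
      - (of_real (real m * c) * (z * cnj z) + of_real (c\<^sup>2) * (w * cnj w))"
    using assms(2) zz wz zw ww
    by (simp add: fefferman_matrix_def Let_def det_3 flip: r_def)
       (simp add: r_def d_zbar_rho d_z_rho d_wbar_rho d_w_rho c_def power2_eq_square algebra_simps)
  also have "\<dots> = - of_real (real m * c * (cmod z)\<^sup>2 + c * (c * (cmod w)\<^sup>2))"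
    by (simp add: complex_norm_square power2_eq_square mult.assoc flip: complex_norm_square)
  also have "real m * c * (cmod z)\<^sup>2 + c * (c * (cmod w)\<^sup>2) =
      real m * c * ((cmod z)\<^sup>2 + (cmod w) ^ (2 * m))"
    unfolding cw by (simp add: algebra_simps)
  also have "\<dots> = (real m)\<^sup>2 * (cmod w) ^ (2 * m - 2)"
    unfolding one by (simp add: c_def power2_eq_square)
  finally have det: "cmod (det (fefferman_matrix m (z, w))) = (real m)\<^sup>2 * (cmod w) ^ (2 * m - 2)"
    by (simp add: norm_mult norm_power)
  have "d_rho_norm m (z, w) = sqrt ((cmod z)\<^sup>2 + c\<^sup>2 * (cmod w)\<^sup>2)"
    by (simp add: d_rho_norm_def Let_def d_z_rho d_w_rho norm_mult norm_power power_mult_distrib c_def)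
  with det show ?thesis
    by (simp add: fefferman_density_def cw2)
qed

end

theory Submission
  imports Defs
begin

text \<open>The approximants are the dilations \<open>p \<mapsto> f (r p)\<close> with \<open>r < 1\<close>, which are holomorphic near the closed
  domain. A second order Taylor bound for \<open>\<rho>\<close> shows that for \<open>r\<close> close to 1, uniformly in the boundary
  point \<open>\<xi>\<close>, the point \<open>r \<xi>\<close> lies in the approach region at \<open>\<xi>\<close>. Hence the dilations are dominated on the
  boundary by the square integrable maximal function of \<open>f\<close>, they converge to the boundary value wherever it
  exists, and dominated convergence applies. Conversely, functions holomorphic near the closed domain
  are bounded there, so they belong to the space because the boundary has finite measure: it is the image
  of the boundary of a cube under the nearest point projection onto the convex set, which is 1-Lipschitz.\<close>

subsection \<open>Hausdorff measure of convex hypersurfaces\<close>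

lemma hausdorff_pre_le_finite_cover:
  fixes A :: "'a::metric_space set"
  assumes "n > 0" "finite I" and A: "A \<subseteq> (\<Union>i\<in>I. V i)"
    and V: "\<And>i. i \<in> I \<Longrightarrow> bounded (V i)" "\<And>i. i \<in> I \<Longrightarrow> diameter (V i) \<le> e"
    and "0 \<le> e" "e \<le> d"
  shows "hausdorff_pre n d A \<le> ennreal (real (card I) * (unit_ball_vol (real n) * (e / 2) ^ n))"
proof -
  obtain h where h: "bij_betw h {0..<card I} I"
    using ex_bij_betw_nat_finite[OF \<open>finite I\<close>] by blast
  \<comment> \<open>The finite cover is padded with empty sets to a sequence. Since
    \<open>n > 0\<close>, the padding contributes nothing to the sum: its terms are
    \<open>0 ^ n\<close>.\<close>
  define U where "U j = (if j < card I then V (h j) else {})" for j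
  have hI: "h j \<in> I" if "j < card I" for j
    using h that by (auto simp: bij_betw_def)
  have "A \<subseteq> (\<Union>j. U j)"
  proof
    fix x assume "x \<in> A"
    with A obtain i where "i \<in> I" "x \<in> V i" by auto
    moreover from this h obtain j where "j < card I" "h j = i"
      by (auto simp: bij_betw_def image_iff) (metis atLeastLessThan_iff imageE)
    ultimately show "x \<in> (\<Union>j. U j)" by (auto simp: U_def)
  qed
  moreover have "bounded (U j) \<and> diameter (U j) \<le> d" for j
    using V hI \<open>0 \<le> e\<close> \<open>e \<le> d\<close> by (auto simp: U_def intro: order_trans)
  ultimately have "hausdorff_pre n d A \<le> (\<Sum>j. ennreal (unit_ball_vol (real n) * (diameter (U j) / 2) ^ n))"
    unfolding hausdorff_pre_def by (intro INF_lower) auto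
  also have "\<dots> = (\<Sum>j<card I. ennreal (unit_ball_vol (real n) * (diameter (U j) / 2) ^ n))"
    using \<open>n > 0\<close> by (intro suminf_finite) (auto simp: U_def)
  also have "\<dots> \<le> (\<Sum>j<card I. ennreal (unit_ball_vol (real n) * (e / 2) ^ n))"
    using V hI by (intro sum_mono ennreal_leI mult_left_mono power_mono)
      (auto simp: U_def diameter_ge_0)
  also have "\<dots> = ennreal (real (card I) * (unit_ball_vol (real n) * (e / 2) ^ n))"
    using \<open>0 \<le> e\<close> by (simp add: ennreal_mult ennreal_of_nat_eq_real_of_nat)
  finally show ?thesis .
qed

text \<open>A boundary point \<open>x\<close> has a supporting hyperplane with inward normal
  \<open>l\<close>. Following the ray in direction \<open>- l\<close> out of the convex set until it
  meets the boundary of the box gives a point whose nearest point in the closure is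
  \<open>x\<close>.\<close>

lemma frontier_convex_subset_closest_point_box_frontier:
  fixes S :: "'a::euclidean_space set"
  assumes "convex S" "interior S \<noteq> {}" and S: "closure S \<subseteq> box a b"
  shows "frontier S \<subseteq> closest_point (closure S) ` frontier (cbox a b)"
proof
  fix x assume x: "x \<in> frontier S"
  then have xS: "x \<in> closure S" by (simp add: frontier_def)
  have "interior (closure S) = interior S"
    using assms by (simp add: convex_interior_closure)
  moreover have "rel_interior (closure S) = interior (closure S)"
    using assms by (intro rel_interior_nonempty_interior) (simp add: convex_interior_closure)
  ultimately have "x \<notin> rel_interior (closure S)"
    using x by (simp add: frontier_def)
  then obtain l where l: "l \<noteq> 0" "\<And>y. y \<in> closure S \<Longrightarrow> l \<bullet> x \<le> l \<bullet> y"
    by (rule supporting_hyperplane_rel_boundary[OF convex_closure[OF \<open>convex S\<close>] xS]) (rule that, assumption+)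
  have "x \<in> interior (cbox a b)" using xS S by auto
  then obtain d where d: "0 < d" "x + d *\<^sub>R (- l) \<in> frontier (cbox a b)"
    using ray_to_frontier[OF bounded_cbox] l(1) by (metis neg_0_equal_iff_equal)
  let ?q = "x + d *\<^sub>R (- l)"
  have "\<forall>z\<in>closure S. dist ?q x \<le> dist ?q z"
  proof
    fix z assume "z \<in> closure S"
    then have "d * (l \<bullet> x) \<le> d * (l \<bullet> z)" using l(2) d by (intro mult_left_mono) auto
    \<comment> \<open>The cross term is nonnegative because \<open>l\<close> supports the set at
      \<open>x\<close>.\<close>
    moreover have "(norm (?q - z))\<^sup>2 =
        (norm (?q - x))\<^sup>2 + (norm (x - z))\<^sup>2 + 2 * (d * (l \<bullet> z) - d * (l \<bullet> x))"
      by (simp add: power2_norm_eq_inner inner_simps inner_commute algebra_simps) (simp add: power2_eq_square)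
    ultimately have "(norm (?q - x))\<^sup>2 \<le> (norm (?q - z))\<^sup>2"
      by (simp add: add_increasing2)
    then show "dist ?q x \<le> dist ?q z" by (simp add: dist_norm)
  qed
  then have "x = closest_point (closure S) ?q"
    using convex_closure[OF \<open>convex S\<close>] xS by (intro closest_point_unique) auto
  with d show "x \<in> closest_point (closure S) ` frontier (cbox a b)" by blast
qed

text \<open>A surrounding cube \<open>[-L, L]^D\<close> has its facets cut into a grid of mesh
  \<open>2 * L / N\<close>. The nearest point projection does not increase diameters, so the images
  of the grid cells cover the frontier. There are of order \<open>N ^ n\<close> of them, each
  contributing of order \<open>N powr (- n)\<close>, so the total stays bounded as the mesh
  shrinks.\<close>

lemma hausdorff_outer_frontier_convex_finite:
  fixes S :: "'a::euclidean_space set"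
  assumes "convex S" "bounded S" "interior S \<noteq> {}" and n: "DIM('a) = Suc n" "n > 0"
  shows "hausdorff_outer n (frontier S) < \<infinity>"
proof -
  define D where "D = real DIM('a)"
  obtain L0 where L0: "closure S \<subseteq> ball 0 L0"
    using bounded_subset_ballD[OF bounded_closure[OF \<open>bounded S\<close>]] by blast
  define L where "L = \<bar>L0\<bar> + 1"
  have L: "L > 0" by (simp add: L_def)
  have D: "D > 0" by (simp add: D_def)
  let ?b = "(\<Sum>i\<in>Basis. L *\<^sub>R i) :: 'a" and ?a = "- (\<Sum>i\<in>Basis. L *\<^sub>R i) :: 'a"
  have "ball 0 L0 \<subseteq> box ?a ?b"
  proof
    fix x :: 'a assume "x \<in> ball 0 L0"
    then have "\<bar>x \<bullet> i\<bar> < L" if "i \<in> Basis" for i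
      using Basis_le_norm[OF that, of x] by (simp add: L_def)
    then have "- L < x \<bullet> i \<and> x \<bullet> i < L" if "i \<in> Basis" for i
      using that by (simp add: abs_less_iff minus_less_iff)
    then show "x \<in> box ?a ?b" by (simp add: mem_box)
  qed
  with L0 have "closure S \<subseteq> box ?a ?b" by blast
  note fr = frontier_convex_subset_closest_point_box_frontier[OF assms(1,3) this]
  have S: "convex (closure S)" "closed (closure S)" "closure S \<noteq> {}"
    using assms by auto
  \<comment> \<open>There are \<open>2 * D * (N + 1) ^ n\<close> cells of diameter at most
    \<open>e = D * (2 * L / N)\<close>, and \<open>N + 1 \<le> 2 * N\<close> gives
    \<open>(N + 1) * (e / 2) \<le> 2 * D * L\<close>, a bound free of \<open>N\<close>.\<close>
  define C where "C = 2 * D * (unit_ball_vol (real n) * (2 * D * L) ^ n)"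
  have "hausdorff_pre n d (frontier S) \<le> ennreal C" if "d > 0" for d
  proof -
    obtain N :: nat where N: "D * (2 * L) / d < real N" using reals_Archimedean2 by blast
    moreover have "0 < D * (2 * L) / d" using D L that by simp
    ultimately have N0: "real N > 0" by linarith
    define e where "e = D * (2 * L / N)"
    have e: "0 \<le> e" "e \<le> d" using N N0 D L that by (auto simp: e_def field_simps)
    \<comment> \<open>The pair \<open>b\<close>, \<open>s\<close> selects a facet by its normal
      direction and side; \<open>k\<close> holds the grid indices of the remaining \<open>n\<close>
      coordinates.\<close>
    define cell where "cell = (\<lambda>(b::'a, s::real, k::'a \<Rightarrow> nat).
      {x::'a. x \<bullet> b = s * L \<and> (\<forall>i\<in>Basis - {b}. 2 * L / N * k i \<le> x \<bullet> i + L \<and>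
                                      x \<bullet> i + L \<le> 2 * L / N * k i + 2 * L / N)})"
    \<comment> \<open>The indices run up to \<open>N\<close> inclusive, because a coordinate equal
      to \<open>L\<close> is assigned the index \<open>N\<close> by the floor function.\<close>
    define I where "I = Sigma (Basis::'a set) (\<lambda>b. {1, -1::real} \<times> PiE (Basis - {b}) (\<lambda>_. {..N}))"
    have "card ({1, -1::real} \<times> PiE (Basis - {b}) (\<lambda>_. {..N})) = 2 * (N + 1) ^ n" if "b \<in> Basis" for b :: 'a
      using that n by (simp add: card_cartesian_product card_PiE)
    then have cardI: "card I = DIM('a) * (2 * (N + 1) ^ n)"
      unfolding I_def by (subst card_SigmaI) (auto intro!: finite_PiE)
    have finI: "finite I" unfolding I_def by (auto intro!: finite_PiE finite_SigmaI)
    have dist_cell: "dist x y \<le> e" if "x \<in> cell j" "y \<in> cell j" "j \<in> I" for x y j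
    proof -
      obtain b s k where j: "j = (b, s, k)" by (cases j) auto
      have "\<bar>(x - y) \<bullet> i\<bar> \<le> 2 * L / N" if "i \<in> Basis" for i
      proof (cases "i = b")
        case True
        then show ?thesis using \<open>x \<in> cell j\<close> \<open>y \<in> cell j\<close> L N0 by (auto simp: cell_def j inner_diff_left)
      next
        case False
        with that have "2 * L / N * k i \<le> x \<bullet> i + L" "x \<bullet> i + L \<le> 2 * L / N * k i + 2 * L / N"
           "2 * L / N * k i \<le> y \<bullet> i + L" "y \<bullet> i + L \<le> 2 * L / N * k i + 2 * L / N"
          using \<open>x \<in> cell j\<close> \<open>y \<in> cell j\<close> by (auto simp: cell_def j)
        then show ?thesis unfolding inner_diff_left by linarith
      qed
      then have "(\<Sum>i\<in>Basis. \<bar>(x - y) \<bullet> i\<bar>) \<le> (\<Sum>i\<in>(Basis::'a set). 2 * L / N)" by (rule sum_mono)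
      also have "\<dots> = e" by (simp add: e_def D_def)
      finally show ?thesis using norm_le_l1[of "x - y"] by (simp add: dist_norm)
    qed
    have dist_image: "dist x y \<le> e"
      if "x \<in> closest_point (closure S) ` cell j" "y \<in> closest_point (closure S) ` cell j" "j \<in> I" for x y j
    proof -
      from that obtain x' y' where xy: "x' \<in> cell j" "y' \<in> cell j"
        and *: "x = closest_point (closure S) x'" "y = closest_point (closure S) y'" by blast
      have "dist x y \<le> dist x' y'" unfolding * by (rule closest_point_lipschitz[OF S])
      also have "\<dots> \<le> e" using xy \<open>j \<in> I\<close> by (rule dist_cell)
      finally show ?thesis .
    qed
    have facets: "frontier (cbox ?a ?b) \<subseteq> (\<Union>j\<in>I. cell j)"
    proof
      fix x assume x: "x \<in> frontier (cbox ?a ?b)"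
      then have xi: "- L \<le> x \<bullet> i" "x \<bullet> i \<le> L" if "i \<in> Basis" for i
        using that by (auto simp: frontier_cbox mem_box)
      from x obtain b where b: "b \<in> Basis" "x \<bullet> b \<le> - L \<or> L \<le> x \<bullet> b"
        by (force simp: frontier_cbox mem_box not_less)
      with xi[of b] have "x \<bullet> b = 1 * L \<or> x \<bullet> b = - 1 * L" by auto
      then obtain s where s: "s \<in> {1, -1}" "x \<bullet> b = s * L" by blast
      define u where "u i = (x \<bullet> i + L) * N / (2 * L)" for i
      define k where "k = restrict (\<lambda>i. nat \<lfloor>u i\<rfloor>) (Basis - {b})"
      have u: "0 \<le> u i" "u i \<le> N" if "i \<in> Basis" for i
      proof -
        have "0 \<le> (x \<bullet> i + L) * N" "(x \<bullet> i + L) * N \<le> 2 * L * N"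
          using xi[OF that] by (auto intro: mult_right_mono)
        then show "0 \<le> u i" "u i \<le> N" using L by (auto simp: u_def field_simps)
      qed
      have ux: "x \<bullet> i + L = 2 * L / N * u i" for i using L N0 by (simp add: u_def)
      have "k \<in> PiE (Basis - {b}) (\<lambda>_. {..N})"
      proof (rule PiE_I)
        fix i assume "i \<in> Basis - {b}"
        then have "nat \<lfloor>u i\<rfloor> \<le> N" using u[of i] by (auto simp: nat_le_iff floor_le_iff)
        with \<open>i \<in> Basis - {b}\<close> show "k i \<in> {..N}" by (simp add: k_def)
      qed (auto simp: k_def)
      moreover have "x \<in> cell (b, s, k)"
      proof -
        have "2 * L / N * k i \<le> x \<bullet> i + L \<and> x \<bullet> i + L \<le> 2 * L / N * k i + 2 * L / N"
          if i: "i \<in> Basis - {b}" for i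
        proof -
          have "real (k i) = \<lfloor>u i\<rfloor>" using i u[of i] by (simp add: k_def)
          then have "real (k i) \<le> u i" "u i \<le> real (k i) + 1" by linarith+
          moreover have "2 * L / N \<ge> 0" using L by simp
          ultimately have "2 * L / N * real (k i) \<le> 2 * L / N * u i"
              "2 * L / N * u i \<le> 2 * L / N * (real (k i) + 1)"
            by - (rule mult_left_mono; assumption)+
          then show ?thesis unfolding ux by (simp add: distrib_left)
        qed
        with s show ?thesis by (auto simp: cell_def)
      qed
      moreover have "(b, s, k) \<in> I" using calculation b s by (simp add: I_def)
      ultimately show "x \<in> (\<Union>j\<in>I. cell j)" by blast
    qed
    have "hausdorff_pre n d (frontier S) \<le> ennreal (real (card I) * (unit_ball_vol (real n) * (e / 2) ^ n))"
    proof (rule hausdorff_pre_le_finite_cover[where V = "\<lambda>j. closest_point (closure S) ` cell j", OF n(2) finI _ _ _ e])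
      show "frontier S \<subseteq> (\<Union>j\<in>I. closest_point (closure S) ` cell j)"
        using order_trans[OF fr image_mono[OF facets]] by (simp only: image_UN)
      show "bounded (closest_point (closure S) ` cell j)" if "j \<in> I" for j
        unfolding bounded_two_points by (intro exI[of _ e] ballI) (rule dist_image[OF _ _ that])
      show "diameter (closest_point (closure S) ` cell j) \<le> e" if "j \<in> I" for j
      proof (rule diameter_le)
        fix x y assume "x \<in> closest_point (closure S) ` cell j" "y \<in> closest_point (closure S) ` cell j"
        then show "norm (x - y) \<le> e" using dist_image[OF _ _ that, of x y] by (simp add: dist_norm)
      qed (use e in simp)
    qed
    also have "real (card I) * (unit_ball_vol (real n) * (e / 2) ^ n) =
        2 * D * (unit_ball_vol (real n) * ((real N + 1) * (e / 2)) ^ n)"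
      unfolding cardI power_mult_distrib[of "real N + 1"] by (simp add: D_def add.commute)
    also have "\<dots> \<le> C"
    proof -
      have "(real N + 1) * (e / 2) \<le> 2 * real N * (e / 2)"
        using N0 e by (intro mult_right_mono) auto
      also have "\<dots> = 2 * D * L" using N0 by (simp add: e_def)
      finally show ?thesis unfolding C_def using D e
        by (intro mult_left_mono power_mono) auto
    qed
    finally show ?thesis by (simp add: ennreal_leI)
  qed
  then have "hausdorff_outer n (frontier S) \<le> ennreal C"
    unfolding hausdorff_outer_def by (auto intro: SUP_least)
  then show ?thesis by (rule le_less_trans) simp
qed

text \<open>Only this inequality is needed, and it does not depend on the countable additivity of the outer
  measure on Borel sets: without it, \<^const>\<open>measure_of\<close> would return the zero measure.\<close>

lemma emeasure_hausdorff_measure_le: "emeasure (hausdorff_measure n) A \<le> hausdorff_outer n A"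
  unfolding hausdorff_measure_def by (simp add: emeasure_measure_of_conv)

subsection \<open>Geometry of the domain\<close>

lemma dom2m_altdef: "dom2m m = {p. rho m p < 0}"
  by (auto simp: dom2m_def rho_def)

lemma continuous_on_rho: "continuous_on A (rho m)"
  unfolding rho_def by (intro continuous_intros)

lemma open_dom2m: "open (dom2m m)"
  unfolding dom2m_altdef by (intro open_Collect_less continuous_on_rho continuous_intros)

lemma closure_dom2m_subset: "closure (dom2m m) \<subseteq> {p. rho m p \<le> 0}"
  by (intro closure_minimal closed_Collect_le continuous_on_rho continuous_intros)
    (auto simp: dom2m_altdef)

lemma rho_frontier: "\<xi> \<in> frontier (dom2m m) \<Longrightarrow> rho m \<xi> = 0"
  using closure_dom2m_subset[of m] interior_open[OF open_dom2m[of m]]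
  by (fastforce simp: frontier_def dom2m_altdef)

lemma rho_nonpos_bounds:
  assumes "m > 0" "rho m p \<le> 0"
  shows "cmod (fst p) \<le> 1" "cmod (snd p) \<le> 1" "norm p \<le> 2"
proof -
  have "cmod (fst p) ^ 2 \<le> 1" "cmod (snd p) ^ (2 * m) \<le> 1"
    using assms(2) zero_le_power2[of "cmod (fst p)"] zero_le_power[OF norm_ge_zero, of "snd p" "2 * m"]
    unfolding rho_def by linarith+
  then show *: "cmod (fst p) \<le> 1" "cmod (snd p) \<le> 1"
    using \<open>m > 0\<close> by (simp_all add: power_le_one_iff abs_square_le_1)
  have "norm p \<le> cmod (fst p) + cmod (snd p)"
    by (cases p) (simp add: norm_Pair_le)
  with * show "norm p \<le> 2" by linarith
qed

lemma bounded_dom2m: "m > 0 \<Longrightarrow> bounded (dom2m m)"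
  using rho_nonpos_bounds(3)[of m] by (auto simp: bounded_iff dom2m_altdef intro!: exI[of _ 2])

lemma zero_in_dom2m: "m > 0 \<Longrightarrow> 0 \<in> dom2m m"
  by (simp add: dom2m_altdef rho_def power_0_left)

text \<open>Dilations carry the closed domain into the open one: since
  \<open>r ^ (2 * m) \<le> r ^ 2\<close>, the quantity \<open>rho + 1\<close> shrinks at least by
  the factor \<open>r ^ 2\<close>.\<close>

lemma rho_scaleR_neg:
  assumes "m > 0" "rho m p \<le> 0" "0 \<le> r" "r < 1"
  shows "rho m (r *\<^sub>R p) < 0"
proof -
  have "r ^ (2 * m) \<le> r ^ 2" using assms by (intro power_decreasing) auto
  then have "r ^ (2 * m) * cmod (snd p) ^ (2 * m) \<le> r\<^sup>2 * cmod (snd p) ^ (2 * m)"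
    by (intro mult_right_mono) auto
  then have "rho m (r *\<^sub>R p) \<le> r\<^sup>2 * (rho m p + 1) - 1"
    using assms by (simp add: rho_def power_mult_distrib distrib_left)
  also have "\<dots> \<le> r\<^sup>2 * 1 - 1"
    using assms by (intro diff_right_mono mult_left_mono) auto
  also have "\<dots> < 0" using assms by (simp add: power_less_one_iff abs_square_less_1)
  finally show ?thesis .
qed

text \<open>Even powers of the modulus are convex, so \<open>rho m\<close> is a convex function and
  the domain is one of its sublevel sets.\<close>

lemma convex_dom2m: "convex (dom2m m)"
proof -
  have even_power: "norm (u *\<^sub>R x + v *\<^sub>R y) ^ (2 * k) \<le> u * norm x ^ (2 * k) + v * norm y ^ (2 * k)"
    if "0 \<le> u" "0 \<le> v" "u + v = 1" for u v k and x y :: complex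
  proof -
    have "norm (u *\<^sub>R x + v *\<^sub>R y) \<le> u * norm x + v * norm y"
      using that norm_triangle_ineq[of "u *\<^sub>R x" "v *\<^sub>R y"] by simp
    then have "norm (u *\<^sub>R x + v *\<^sub>R y) ^ (2 * k) \<le> (u * norm x + v * norm y) ^ (2 * k)"
      by (intro power_mono) auto
    also have "\<dots> \<le> u * norm x ^ (2 * k) + v * norm y ^ (2 * k)"
      using convex_power_even[of "2 * k"] that by (auto simp: convex_on_def)
    finally show ?thesis .
  qed
  have "rho m (u *\<^sub>R x + v *\<^sub>R y) \<le> u * rho m x + v * rho m y"
    if "0 \<le> u" "0 \<le> v" "u + v = 1" for u v x y
  proof -
    have "rho m (u *\<^sub>R x + v *\<^sub>R y) \<le> (u * norm (fst x) ^ (2 * 1) + v * norm (fst y) ^ (2 * 1))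
        + (u * norm (snd x) ^ (2 * m) + v * norm (snd y) ^ (2 * m)) - (u + v)"
      using even_power[OF that, of "fst x" "fst y" 1] even_power[OF that, of "snd x" "snd y" m] that(3)
      by (simp add: rho_def)
    also have "\<dots> = u * rho m x + v * rho m y" by (simp add: rho_def algebra_simps power2_eq_square)
    finally show ?thesis .
  qed
  then show ?thesis
    unfolding dom2m_altdef convex_def using convex_bound_lt[of "rho m x" 0 "rho m y" for x y]
    by (metis le_less_trans mem_Collect_eq)
qed

section \<open>The gradient of the defining function and its Taylor bound\<close>

text \<open>Half the real gradient of \<open>rho m\<close> under the identification with
  \<open>R^4\<close>, that is, the pair of its conjugate derivatives in closed form.\<close>

definition half_grad :: "nat \<Rightarrow> c2 \<Rightarrow> c2" where
  "half_grad m p = (fst p, of_real (real m * cmod (snd p) ^ (2 * m - 2)) * snd p)"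

lemma outward_normal_eq: "outward_normal m \<xi> = sgn (half_grad m \<xi>)"
  by (simp add: outward_normal_def half_grad_def d_zbar_rho d_wbar_rho Let_def)

lemma continuous_on_half_grad: "continuous_on A (half_grad m)"
  unfolding half_grad_def by (intro continuous_intros)

text \<open>Each component of \<open>half_grad m p\<close> is a nonnegative multiple of the same
  component of \<open>p\<close>, so the Hermitian product is real. For radial displacements the
  complex and the real normal component therefore agree.\<close>

lemma cdot_half_grad: "cdot p (cnj2 (half_grad m p)) = of_real (p \<bullet> half_grad m p)"
  by (auto simp: cdot_def cnj2_def half_grad_def inner_prod_def inner_complex_def complex_eq_iff algebra_simps)

lemma inner_half_grad:
  assumes "m > 0"
  shows "p \<bullet> half_grad m p = (cmod (fst p))\<^sup>2 + real m * cmod (snd p) ^ (2 * m)"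
proof -
  have "cmod (snd p) ^ (2 * m) = cmod (snd p) ^ (2 * m - 2) * (cmod (snd p))\<^sup>2"
    using assms by (cases m) (simp_all add: power2_eq_square)
  moreover have "p \<bullet> half_grad m p =
      (cmod (fst p))\<^sup>2 + real m * cmod (snd p) ^ (2 * m - 2) * (cmod (snd p))\<^sup>2"
    unfolding cmod_power2
    by (simp add: half_grad_def inner_prod_def inner_complex_def power2_eq_square algebra_simps)
  ultimately show ?thesis by simp
qed

text \<open>The radial direction is uniformly transversal to the boundary, including the points with
  \<open>w = 0\<close>; in particular the gradient does not vanish there.\<close>

lemma inner_half_grad_ge_1:
  assumes "m > 0" "rho m \<xi> = 0"
  shows "1 \<le> \<xi> \<bullet> half_grad m \<xi>"
proof -
  have "1 * cmod (snd \<xi>) ^ (2 * m) \<le> real m * cmod (snd \<xi>) ^ (2 * m)"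
    using assms by (intro mult_right_mono) auto
  with assms show ?thesis by (simp add: inner_half_grad rho_def)
qed

lemma norm_half_grad_le:
  assumes "m > 0" "rho m \<xi> \<le> 0"
  shows "norm (half_grad m \<xi>) \<le> 1 + real m"
proof -
  note b = rho_nonpos_bounds[OF assms]
  have "norm (half_grad m \<xi>) \<le> cmod (fst \<xi>) + real m * cmod (snd \<xi>) ^ (2 * m - 2) * cmod (snd \<xi>)"
    unfolding half_grad_def by (rule order_trans[OF norm_Pair_le]) (simp add: norm_mult norm_power)
  also have "\<dots> \<le> 1 + real m * 1 * 1"
    using b by (intro add_mono mult_mono) (auto intro!: power_le_one)
  finally show ?thesis by simp
qed

text \<open>The remainders obey the recursion
  \<open>R (n + 1) = y * R n + n * x ^ (n - 1) * (y - x) ^ 2\<close>, so a constant uniform on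
  \<open>[-B, B]\<close> is carried through the induction.\<close>

lemma power_taylor2:
  fixes B :: real
  assumes "0 \<le> B"
  shows "\<exists>K\<ge>0. \<forall>x y. \<bar>x\<bar> \<le> B \<longrightarrow> \<bar>y\<bar> \<le> B \<longrightarrow>
           \<bar>y ^ n - x ^ n - real n * x ^ (n - 1) * (y - x)\<bar> \<le> K * (y - x)\<^sup>2"
proof (induction n)
  case 0
  show ?case by (intro exI[of _ 0]) simp
next
  case (Suc n)
  then obtain K where K: "K \<ge> 0" "\<And>x y. \<bar>x\<bar> \<le> B \<Longrightarrow> \<bar>y\<bar> \<le> B \<Longrightarrow>
           \<bar>y ^ n - x ^ n - real n * x ^ (n - 1) * (y - x)\<bar> \<le> K * (y - x)\<^sup>2" by blast
  show ?case
  proof (intro exI[of _ "B * K + real n * B ^ (n - 1)"] conjI allI impI)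
    show "0 \<le> B * K + real n * B ^ (n - 1)" using assms K by simp
    fix x y :: real assume xy: "\<bar>x\<bar> \<le> B" "\<bar>y\<bar> \<le> B"
    let ?R = "y ^ n - x ^ n - real n * x ^ (n - 1) * (y - x)"
    have "y ^ Suc n - x ^ Suc n - real (Suc n) * x ^ (Suc n - 1) * (y - x)
        = y * ?R + real n * x ^ (n - 1) * (y - x)\<^sup>2"
      by (cases n) (simp_all add: algebra_simps power2_eq_square)
    then have "\<bar>y ^ Suc n - x ^ Suc n - real (Suc n) * x ^ (Suc n - 1) * (y - x)\<bar>
        \<le> \<bar>y\<bar> * \<bar>?R\<bar> + real n * \<bar>x\<bar> ^ (n - 1) * (y - x)\<^sup>2"
      using abs_triangle_ineq[of "y * ?R" "real n * x ^ (n - 1) * (y - x)\<^sup>2"]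
      by (simp add: abs_mult power_abs)
    also have "\<dots> \<le> B * (K * (y - x)\<^sup>2) + real n * B ^ (n - 1) * (y - x)\<^sup>2"
    proof (rule add_mono)
      show "\<bar>y\<bar> * \<bar>?R\<bar> \<le> B * (K * (y - x)\<^sup>2)"
        using xy K(2) assms by (intro mult_mono) auto
      show "real n * \<bar>x\<bar> ^ (n - 1) * (y - x)\<^sup>2 \<le> real n * B ^ (n - 1) * (y - x)\<^sup>2"
        using xy by (intro mult_right_mono mult_left_mono power_mono) auto
    qed
    finally show "\<bar>y ^ Suc n - x ^ Suc n - real (Suc n) * x ^ (Suc n - 1) * (y - x)\<bar>
        \<le> (B * K + real n * B ^ (n - 1)) * (y - x)\<^sup>2" by (simp add: algebra_simps)
  qed
qed

text \<open>The higher power is treated as the \<open>m\<close>-th power of the squared modulus,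
  which reduces the bound to one real variable. The constant is uniform in \<open>p\<close> over the
  closed sublevel set.\<close>

lemma rho_taylor2:
  assumes "m > 0"
  shows "\<exists>C\<ge>0. \<forall>p u. rho m p \<le> 0 \<longrightarrow> norm u \<le> 4 \<longrightarrow>
           rho m (p + u) \<le> rho m p + 2 * (half_grad m p \<bullet> u) + C * (norm u)\<^sup>2"
proof -
  \<comment> \<open>Here \<open>cmod w \<le> 1\<close> and \<open>cmod b \<le> 4\<close>, so both
    squared moduli stay below \<open>5 * 5 = 25\<close>.\<close>
  obtain K where K: "K \<ge> 0" "\<And>x y. \<bar>x\<bar> \<le> 25 \<Longrightarrow> \<bar>y\<bar> \<le> 25 \<Longrightarrow>
           \<bar>y ^ m - x ^ m - real m * x ^ (m - 1) * (y - x)\<bar> \<le> K * (y - x)\<^sup>2"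
    using power_taylor2[of 25 m] by auto
  \<comment> \<open>In the constant, \<open>1\<close> comes from the square of \<open>a\<close>,
    \<open>real m\<close> from the quadratic part of \<open>y - x\<close>, and \<open>36 * K\<close>
    from \<open>\<bar>y - x\<bar> \<le> 6 * cmod b\<close>.\<close>
  have "rho m (p + u) \<le> rho m p + 2 * (half_grad m p \<bullet> u) + (1 + real m + 36 * K) * (norm u)\<^sup>2"
    if p: "rho m p \<le> 0" and u: "norm u \<le> 4" for p u
  proof -
    obtain z w a b where pu: "p = (z, w)" "u = (a, b)" by (cases p, cases u)
    have w: "cmod w \<le> 1" using rho_nonpos_bounds[OF \<open>m > 0\<close> p] by (simp add: pu)
    have b: "cmod b \<le> 4" using u norm_snd_le[of b a] by (simp add: pu)
    define x y where "x = (cmod w)\<^sup>2" and "y = (cmod (w + b))\<^sup>2"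
    have yx: "y - x = 2 * (w \<bullet> b) + (cmod b)\<^sup>2"
      by (simp add: x_def y_def power2_norm_eq_inner inner_simps inner_commute)
    have x1: "0 \<le> x" "x \<le> 1" using w by (simp_all add: x_def abs_square_le_1)
    have wb: "cmod (w + b) \<le> 5" using norm_triangle_ineq[of w b] w b by linarith
    have y25: "0 \<le> y" "y \<le> 25" using power_mono[OF wb, of 2] by (simp_all add: y_def)
    have "\<bar>y - x\<bar> \<le> 2 * (cmod w * cmod b) + cmod b * cmod b"
      using Cauchy_Schwarz_ineq2[of w b] abs_triangle_ineq[of "2 * (w \<bullet> b)" "cmod b * cmod b"]
      unfolding yx power2_eq_square by simp
    also have "\<dots> \<le> 2 * (1 * cmod b) + 4 * cmod b"
      using w b by (intro add_mono mult_left_mono mult_right_mono) auto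
    finally have "(y - x)\<^sup>2 \<le> (6 * cmod b)\<^sup>2" using power_mono[of "\<bar>y - x\<bar>" "6 * cmod b" 2] by simp
    then have "K * (y - x)\<^sup>2 \<le> K * (6 * cmod b)\<^sup>2" using K by (intro mult_left_mono)
    moreover have "y ^ m - x ^ m - real m * x ^ (m - 1) * (y - x) \<le> K * (y - x)\<^sup>2"
      using K(2)[of x y] x1 y25 by linarith
    moreover have "real m * x ^ (m - 1) * (y - x) \<le> 2 * (real m * x ^ (m - 1) * (w \<bullet> b)) + real m * (cmod b)\<^sup>2"
    proof -
      have "real m * x ^ (m - 1) * (cmod b)\<^sup>2 \<le> real m * 1 * (cmod b)\<^sup>2"
        using x1 by (intro mult_right_mono mult_left_mono power_le_one) auto
      then show ?thesis unfolding yx by (simp add: algebra_simps)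
    qed
    moreover have "(cmod (z + a))\<^sup>2 = (cmod z)\<^sup>2 + 2 * (z \<bullet> a) + (cmod a)\<^sup>2"
      by (simp add: power2_norm_eq_inner inner_simps inner_commute)
    moreover have "half_grad m p \<bullet> u = z \<bullet> a + real m * x ^ (m - 1) * (w \<bullet> b)"
    proof -
      have "cmod w ^ (2 * m - 2) = x ^ (m - 1)"
        by (simp add: x_def power_mult[symmetric] right_diff_distrib')
      then show ?thesis
        by (simp add: half_grad_def pu inner_complex_def algebra_simps)
    qed
    moreover have "rho m p = (cmod z)\<^sup>2 + x ^ m - 1" "rho m (p + u) = (cmod (z + a))\<^sup>2 + y ^ m - 1"
      by (simp_all add: rho_def pu x_def y_def power_mult)
    moreover have "(norm u)\<^sup>2 = (cmod a)\<^sup>2 + (cmod b)\<^sup>2"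
      by (simp add: pu norm_Pair)
    moreover have "0 \<le> (real m + 36 * K) * (cmod a)\<^sup>2 + (cmod b)\<^sup>2" using K by simp
    ultimately show ?thesis by (simp add: algebra_simps power_mult_distrib)
  qed
  then show ?thesis using K(1) by (intro exI[of _ "1 + real m + 36 * K"]) auto
qed

section \<open>Distances to the tangent plane and the approach regions\<close>

lemma infdist_hyperplane:
  fixes p \<xi> \<nu> :: "'a::real_inner"
  assumes "norm \<nu> = 1"
  shows "infdist p {x. (x - \<xi>) \<bullet> \<nu> = 0} = \<bar>(p - \<xi>) \<bullet> \<nu>\<bar>"
proof (rule antisym)
  let ?x = "p - ((p - \<xi>) \<bullet> \<nu>) *\<^sub>R \<nu>"
  have "\<nu> \<bullet> \<nu> = 1" using assms by (simp add: norm_eq_1)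
  then have x: "?x \<in> {x. (x - \<xi>) \<bullet> \<nu> = 0}" by (simp add: inner_diff_left)
  have "infdist p {x. (x - \<xi>) \<bullet> \<nu> = 0} \<le> dist p ?x" by (rule infdist_le[OF x])
  also have "\<dots> = \<bar>(p - \<xi>) \<bullet> \<nu>\<bar>" using assms by (simp add: dist_norm)
  finally show "infdist p {x. (x - \<xi>) \<bullet> \<nu> = 0} \<le> \<bar>(p - \<xi>) \<bullet> \<nu>\<bar>" .
  have "\<bar>(p - \<xi>) \<bullet> \<nu>\<bar> \<le> dist p y" if "(y - \<xi>) \<bullet> \<nu> = 0" for y
  proof -
    have "(p - \<xi>) \<bullet> \<nu> = (p - y) \<bullet> \<nu>" using that by (simp add: inner_diff_left)
    then show ?thesis using Cauchy_Schwarz_ineq2[of "p - y" \<nu>] assms by (simp add: dist_norm)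
  qed
  with x show "\<bar>(p - \<xi>) \<bullet> \<nu>\<bar> \<le> infdist p {x. (x - \<xi>) \<bullet> \<nu> = 0}"
    by (subst infdist_notempty) (auto intro!: cINF_greatest)
qed

lemma delta_eq:
  assumes "half_grad m \<xi> \<noteq> 0"
  shows "delta m \<xi> p = min (infdist p (frontier (dom2m m))) \<bar>(p - \<xi>) \<bullet> outward_normal m \<xi>\<bar>"
  using assms by (simp add: delta_def tangent_plane_def infdist_hyperplane outward_normal_eq norm_sgn)

text \<open>That the radius \<open>r0\<close> is uniform in \<open>\<xi>\<close> is what makes the dilations of \<open>f\<close> dominated by the
  maximal function. The constant \<open>\<beta>\<close> is the fraction of the distance \<open>t * \<kappa>\<close> to the tangent plane
  that is guaranteed to be a lower bound for the distance to the boundary.\<close>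

lemma radius_in_approach_region:
  assumes "m > 0" "\<alpha> > 0"
  obtains r0 where "0 \<le> r0" "r0 < 1"
    "\<And>\<xi> r. \<xi> \<in> frontier (dom2m m) \<Longrightarrow> r0 < r \<Longrightarrow> r < 1 \<Longrightarrow> r *\<^sub>R \<xi> \<in> approach_region m \<alpha> \<xi>"
proof -
  obtain C where C: "C \<ge> 0" "\<And>p u. rho m p \<le> 0 \<Longrightarrow> norm u \<le> 4 \<Longrightarrow>
      rho m (p + u) \<le> rho m p + 2 * (half_grad m p \<bullet> u) + C * (norm u)\<^sup>2"
    using rho_taylor2[OF \<open>m > 0\<close>] by blast
  \<comment> \<open>Two requirements are met: \<beta> < 1 leaves a first order decrease of
    \<open>rho\<close> to absorb the Taylor error, and (1 + \<alpha>) * \<beta> > 1 yields the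
    strict inequality in the first approach condition.\<close>
  define \<beta> where "\<beta> = 1 / (1 + \<alpha> / 2)"
  have \<beta>: "0 < \<beta>" "\<beta> < 1" "1 < (1 + \<alpha>) * \<beta>" using \<open>\<alpha> > 0\<close> by (simp_all add: \<beta>_def field_simps)
  \<comment> \<open>The first entry keeps displacements within the range of the Taylor bound, the
    second makes the error \<open>C * (4 * t) ^ 2\<close> smaller than the decrease
    \<open>2 * t * (1 - \<beta>)\<close>, and the third serves the quadratic approach
    condition.\<close>
  define t0 where "t0 = min 1 (min ((1 - \<beta>) / (8 * (C + 1))) (\<alpha> * \<beta> / (4 * (1 + real m))))"
  have t0: "0 < t0" "t0 \<le> 1" using \<beta> C \<open>\<alpha> > 0\<close> by (simp_all add: t0_def)
  have "r *\<^sub>R \<xi> \<in> approach_region m \<alpha> \<xi>"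
    if \<xi>: "\<xi> \<in> frontier (dom2m m)" and r: "1 - t0 < r" "r < 1" for \<xi> r
  proof -
    define t where "t = 1 - r"
    have t: "0 < t" "t < 1" "t < (1 - \<beta>) / (8 * (C + 1))" "t < \<alpha> * \<beta> / (4 * (1 + real m))"
      using r t0 by (auto simp: t_def t0_def)
    have rho0: "rho m \<xi> = 0" using \<xi> by (rule rho_frontier)
    then have n2: "norm \<xi> \<le> 2" using rho_nonpos_bounds(3) \<open>m > 0\<close> by simp
    define G where "G = half_grad m \<xi>"
    define N where "N = outward_normal m \<xi>"
    define \<kappa> where "\<kappa> = \<xi> \<bullet> N"
    have G1: "1 \<le> \<xi> \<bullet> G" using inner_half_grad_ge_1[OF \<open>m > 0\<close> rho0] by (simp add: G_def)
    then have G0: "G \<noteq> 0" by auto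
    have NG: "N = G /\<^sub>R norm G" by (simp add: N_def G_def outward_normal_eq sgn_div_norm)
    have nN: "norm N = 1" using G0 by (simp add: NG)
    have \<kappa>G: "norm G * \<kappa> = \<xi> \<bullet> G" using G0 by (simp add: \<kappa>_def NG)
    have nG: "0 < norm G" "norm G \<le> 1 + real m"
      using G0 norm_half_grad_le[OF \<open>m > 0\<close>, of \<xi>] rho0 by (auto simp: G_def)
    have "0 < norm G * \<kappa>" unfolding \<kappa>G using G1 by linarith
    then have \<kappa>0: "0 < \<kappa>" using nG(1) by (rule zero_less_mult_pos)
    have \<kappa>2: "\<kappa> \<le> 2" using norm_cauchy_schwarz[of \<xi> N] nN n2 by (simp add: \<kappa>_def)
    \<comment> \<open>A lower bound for \<kappa> uniform in \<xi>: it lets the squared distance, of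
      order \<open>t ^ 2\<close>, be compared with \<open>t * \<kappa>\<close>.\<close>
    have \<kappa>1: "1 \<le> (1 + real m) * \<kappa>"
    proof -
      have "norm G * \<kappa> \<le> (1 + real m) * \<kappa>" using nG \<kappa>0 by (intro mult_right_mono) auto
      then show ?thesis using \<kappa>G G1 by linarith
    qed
    define s where "s = t * \<kappa> * \<beta>"
    have s: "0 < s" using t \<kappa>0 \<beta> by (simp add: s_def)
    have st: "s \<le> t * \<kappa>" using t \<kappa>0 \<beta> by (simp add: s_def mult_left_le)
    \<comment> \<open>The ball of radius \<open>s\<close> about \<open>r \<xi>\<close> lies in the
      domain. Seen from \<xi>, moving inward by \<open>t\<close> lowers the
      \<open>G\<close>-component by \<open>t * (\<xi> \<bullet> G)\<close>, and \<open>v\<close> can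
      restore at most the fraction \<beta> of this.\<close>
    have inside: "rho m (r *\<^sub>R \<xi> + v) < 0" if v: "norm v < s" for v
    proof -
      define u where "u = v - t *\<^sub>R \<xi>"
      have u: "r *\<^sub>R \<xi> + v = \<xi> + u" by (simp add: u_def t_def algebra_simps)
      have "norm u \<le> norm v + t * norm \<xi>"
        using norm_triangle_ineq4[of v "t *\<^sub>R \<xi>"] t by (simp add: u_def)
      also have "\<dots> \<le> t * \<kappa> + t * norm \<xi>" using v st by linarith
      also have "\<dots> \<le> t * 2 + t * 2" using t \<kappa>2 n2 by (intro add_mono mult_left_mono) auto
      finally have nu: "norm u \<le> 4 * t" by simp
      then have nu4: "norm u \<le> 4" using t by linarith
      have "(norm u)\<^sup>2 \<le> (4 * t)\<^sup>2" using nu by (intro power_mono) auto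
      then have Cu: "C * (norm u)\<^sup>2 \<le> C * (4 * t)\<^sup>2" using C(1) by (intro mult_left_mono)
      have "G \<bullet> v \<le> norm G * norm v" by (rule norm_cauchy_schwarz)
      also have "\<dots> \<le> norm G * s" using v by (intro mult_left_mono) auto
      also have "\<dots> = t * \<beta> * (\<xi> \<bullet> G)" by (simp add: s_def flip: \<kappa>G)
      finally have "G \<bullet> u \<le> - (t * (1 - \<beta>) * (\<xi> \<bullet> G))"
        by (simp add: u_def inner_diff_right inner_commute algebra_simps)
      also have "\<dots> \<le> - (t * (1 - \<beta>) * 1)"
        using t \<beta> G1 by (intro le_imp_neg_le mult_left_mono) auto
      finally have Gu: "G \<bullet> u \<le> - (t * (1 - \<beta>))" by simp
      have "t * (8 * (C + 1)) < 1 - \<beta>" using t(3) C(1) by (simp add: pos_less_divide_eq)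
      then have "t * (t * (8 * (C + 1))) < t * (1 - \<beta>)" using t(1) by (rule mult_strict_left_mono)
      moreover have "C * (4 * t)\<^sup>2 \<le> 2 * (t * (t * (8 * (C + 1))))"
        using t by (simp add: power2_eq_square algebra_simps)
      ultimately show ?thesis using C(2)[of \<xi> u] rho0 nu4 Cu Gu unfolding u by (simp add: G_def)
    qed
    have "s \<le> infdist (r *\<^sub>R \<xi>) (frontier (dom2m m))"
    proof -
      have "s \<le> dist (r *\<^sub>R \<xi>) q" if "q \<in> frontier (dom2m m)" for q
        using inside[of "q - r *\<^sub>R \<xi>"] rho_frontier[OF that]
        by (force simp: dist_norm norm_minus_commute)
      then show ?thesis using \<xi> by (subst infdist_notempty) (auto intro!: cINF_greatest)
    qed
    moreover have "(r *\<^sub>R \<xi> - \<xi>) \<bullet> N = - (t * \<kappa>)"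
      by (simp add: t_def \<kappa>_def inner_diff_left algebra_simps)
    ultimately have \<delta>: "s \<le> delta m \<xi> (r *\<^sub>R \<xi>)"
      using st s G0 by (simp add: delta_eq G_def N_def)
    \<comment> \<open>The displacement is \<open>t\<close> times \<xi>, hence radial, so its complex
      normal component is exactly the distance \<open>t * \<kappa>\<close> to the tangent
      plane.\<close>
    have "cdot (\<xi> - r *\<^sub>R \<xi>) (cnj2 N) = of_real (t / norm G) * cdot \<xi> (cnj2 G)"
      by (simp add: cdot_def cnj2_def NG t_def scaleR_conv_of_real field_simps add_divide_distrib diff_divide_distrib)
    also have "\<dots> = of_real (t * \<kappa>)"
      using G0 by (simp add: G_def cdot_half_grad) (simp add: \<kappa>_def NG G_def field_simps)
    finally have "cmod (cdot (\<xi> - r *\<^sub>R \<xi>) (cnj2 N)) = t * \<kappa>"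
      using t \<kappa>0 by (simp add: norm_mult)
    also have "\<dots> < t * \<kappa> * ((1 + \<alpha>) * \<beta>)" using t \<kappa>0 \<beta>(3) by simp
    also have "\<dots> = (1 + \<alpha>) * s" by (simp add: s_def)
    also have "\<dots> \<le> (1 + \<alpha>) * delta m \<xi> (r *\<^sub>R \<xi>)" using \<delta> \<open>\<alpha> > 0\<close> by (intro mult_left_mono) auto
    finally have c1: "cmod (cdot (\<xi> - r *\<^sub>R \<xi>) (cnj2 N)) < (1 + \<alpha>) * delta m \<xi> (r *\<^sub>R \<xi>)" .
    have "norm (\<xi> - r *\<^sub>R \<xi>) = t * norm \<xi>"
    proof -
      have "\<xi> - r *\<^sub>R \<xi> = t *\<^sub>R \<xi>" by (simp add: t_def algebra_simps)
      then show ?thesis using t by simp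
    qed
    also have "\<dots> \<le> t * 2" using n2 t by (intro mult_left_mono) auto
    finally have "(norm (\<xi> - r *\<^sub>R \<xi>))\<^sup>2 \<le> (t * 2)\<^sup>2" by (intro power_mono) auto
    also have "\<dots> = t * (t * 4)" by (simp add: power2_eq_square)
    also have "\<dots> \<le> t * (t * 4 * ((1 + real m) * \<kappa>))"
      using \<kappa>1 t by (intro mult_left_mono) (auto simp: mult_le_cancel_left1)
    also have "\<dots> = t * \<kappa> * (t * (4 * (1 + real m)))" by simp
    also have "\<dots> < t * \<kappa> * (\<alpha> * \<beta>)"
      using t \<kappa>0 by (intro mult_strict_left_mono) (auto simp: pos_less_divide_eq)
    also have "\<dots> = \<alpha> * s" by (simp add: s_def)
    also have "\<dots> \<le> \<alpha> * delta m \<xi> (r *\<^sub>R \<xi>)" using \<delta> \<open>\<alpha> > 0\<close> by (intro mult_left_mono) auto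
    finally have c2: "(norm (\<xi> - r *\<^sub>R \<xi>))\<^sup>2 < \<alpha> * delta m \<xi> (r *\<^sub>R \<xi>)" .
    have "r *\<^sub>R \<xi> \<in> dom2m m" using inside[of 0] s by (simp add: dom2m_altdef)
    with c1 c2 show ?thesis by (simp add: approach_region_def N_def)
  qed
  then show thesis using t0 by (intro that[of "1 - t0"]) auto
qed

subsection \<open>Measurability and finiteness\<close>

lemma half_grad_nonzero: "m > 0 \<Longrightarrow> \<xi> \<in> frontier (dom2m m) \<Longrightarrow> half_grad m \<xi> \<noteq> 0"
  using inner_half_grad_ge_1[of m \<xi>] rho_frontier[of \<xi> m] by auto

lemma sets_hausdorff_measure: "sets (hausdorff_measure n :: 'a::metric_space measure) = sets borel"
  unfolding hausdorff_measure_def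
  using sets.sigma_sets_eq[of "borel :: 'a measure"] by (simp only: sets_measure_of space_borel Pow_UNIV subset_UNIV)

lemma space_hausdorff_measure: "space (hausdorff_measure n) = UNIV"
  unfolding sets_eq_imp_space_eq[OF sets_hausdorff_measure] space_borel ..

lemma sets_sigma_F: "sets (sigma_F m) = sets (restrict_space borel (frontier (dom2m m)))"
  unfolding sigma_F_def sigma_E_def sets_density sets_restrict_space sets_hausdorff_measure ..

lemma space_sigma_F: "space (sigma_F m) = frontier (dom2m m)"
  unfolding sets_eq_imp_space_eq[OF sets_sigma_F] space_restrict_space by simp

text \<open>With \<open>p\<close> fixed and \<xi> varying, the defining inequalities are strict and
  both sides are continuous in \<xi>, because the gradient has no zero on the boundary.\<close>

lemma openin_approach_region:
  assumes "m > 0"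
  shows "openin (top_of_set (frontier (dom2m m))) {\<xi> \<in> frontier (dom2m m). p \<in> approach_region m \<alpha> \<xi>}"
proof (cases "p \<in> dom2m m")
  case True
  let ?F = "frontier (dom2m m)"
  define d where "d \<xi> = min (infdist p ?F) \<bar>(p - \<xi>) \<bullet> sgn (half_grad m \<xi>)\<bar>" for \<xi>
  define h where "h \<xi> = min ((1 + \<alpha>) * d \<xi> - cmod (cdot (\<xi> - p) (cnj2 (sgn (half_grad m \<xi>)))))
     (\<alpha> * d \<xi> - (norm (\<xi> - p))\<^sup>2)" for \<xi>
  have sgn: "continuous_on ?F (\<lambda>\<xi>. sgn (half_grad m \<xi>))"
    using half_grad_nonzero[OF assms] by (intro continuous_on_sgn continuous_on_half_grad) auto
  have "continuous_on ?F h"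
    unfolding h_def d_def cdot_def cnj2_def fst_conv snd_conv
    by (intro continuous_intros sgn)
  then have "openin (top_of_set ?F) (?F \<inter> h -` {0<..})"
    by (rule continuous_openin_preimage_gen) simp
  moreover have "p \<in> approach_region m \<alpha> \<xi> \<longleftrightarrow> 0 < h \<xi>" if "\<xi> \<in> ?F" for \<xi>
    using that True half_grad_nonzero[OF assms, of \<xi>]
    by (simp add: approach_region_def h_def d_def delta_eq outward_normal_eq)
  then have "{\<xi> \<in> ?F. p \<in> approach_region m \<alpha> \<xi>} = ?F \<inter> h -` {0<..}" by auto
  ultimately show ?thesis by simp
qed (simp add: approach_region_def)

text \<open>The supremum is uncountable, but each strict superlevel set is a union of relatively
  open sets of boundary points, one for each \<open>p\<close> with large \<open>cmod (f p)\<close>.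
  So the maximal function is lower semicontinuous.\<close>

lemma borel_measurable_nt_maximal:
  assumes "m > 0"
  shows "nt_maximal m \<alpha> f \<in> borel_measurable (sigma_F m)"
proof (rule borel_measurableI_greater)
  fix y :: ennreal
  let ?F = "frontier (dom2m m)"
  have "{\<xi> \<in> space (sigma_F m). y < nt_maximal m \<alpha> f \<xi>} =
      (\<Union>p\<in>{p. y < ennreal (cmod (f p))}. {\<xi> \<in> ?F. p \<in> approach_region m \<alpha> \<xi>})"
    unfolding space_sigma_F nt_maximal_def less_SUP_iff by blast
  also have "openin (top_of_set ?F) \<dots>"
    by (rule openin_Union) (use openin_approach_region[OF assms] in blast)
  finally obtain T where "open T" "{\<xi> \<in> space (sigma_F m). y < nt_maximal m \<alpha> f \<xi>} = ?F \<inter> T"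
    by (auto simp: openin_open)
  then show "{\<xi> \<in> space (sigma_F m). y < nt_maximal m \<alpha> f \<xi>} \<in> sets (sigma_F m)"
    by (auto simp: sets_sigma_F sets_restrict_space)
qed

text \<open>On the boundary the density has a closed form whose denominator vanishes only at the
  origin. It is thus continuous on a compact set.\<close>

lemma fefferman_density_bounded:
  assumes "m > 0"
  obtains B where "fefferman_density m \<in> borel_measurable (sigma_E m)"
    "\<And>\<xi>. \<xi> \<in> frontier (dom2m m) \<Longrightarrow> fefferman_density m \<xi> \<le> B"
proof -
  let ?F = "frontier (dom2m m)"
  define h where "h p = root 3 ((real m)\<^sup>2 * (cmod (snd p)) ^ (2 * m - 2)) /
           sqrt ((cmod (fst p))\<^sup>2 + (real m)\<^sup>2 * (cmod (snd p)) ^ (4 * m - 2))" for p :: c2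
  have eq: "fefferman_density m p = h p" if "p \<in> ?F" for p
    using fefferman_density_closed_form[OF assms, of "fst p" "snd p"] rho_frontier[OF that]
    by (simp add: h_def)
  have "(cmod (fst p))\<^sup>2 + (real m)\<^sup>2 * (cmod (snd p)) ^ (4 * m - 2) \<noteq> 0" if "p \<in> ?F" for p
  proof
    assume "(cmod (fst p))\<^sup>2 + (real m)\<^sup>2 * (cmod (snd p)) ^ (4 * m - 2) = 0"
    then have "fst p = 0 \<and> snd p = 0"
      using assms by (simp add: add_nonneg_eq_0_iff split: if_splits)
    then show False using rho_frontier[OF that] assms by (simp add: rho_def power_0_left)
  qed
  then have cont: "continuous_on ?F h"
    unfolding h_def by (intro continuous_intros) auto
  have "sets (sigma_E m) = sets (restrict_space borel ?F)"
    using sets_sigma_F[of m] by (simp add: sigma_F_def)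
  then have "h \<in> borel_measurable (sigma_E m)"
    using borel_measurable_continuous_on_restrict[OF cont] measurable_cong_sets by blast
  moreover have "space (sigma_E m) = ?F" using space_sigma_F[of m] by (simp add: sigma_F_def)
  ultimately have "fefferman_density m \<in> borel_measurable (sigma_E m)"
    using eq by (subst measurable_cong[where g = h]) auto
  moreover have "compact ?F" using bounded_dom2m[OF assms] by (rule compact_frontier_bounded)
  then have "bounded (h ` ?F)" using cont compact_continuous_image compact_imp_bounded by blast
  then obtain B where "\<And>x. x \<in> ?F \<Longrightarrow> norm (h x) \<le> B" by (auto simp: bounded_iff)
  then have "fefferman_density m \<xi> \<le> B" if "\<xi> \<in> ?F" for \<xi>
    using that by (simp add: eq) (metis abs_le_D1 real_norm_def)
  ultimately show thesis by (rule that)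
qed

lemma emeasure_sigma_F_finite:
  assumes "m > 0"
  shows "emeasure (sigma_F m) (space (sigma_F m)) < \<infinity>"
proof -
  let ?F = "frontier (dom2m m)"
  obtain B where B: "fefferman_density m \<in> borel_measurable (sigma_E m)"
    "\<And>\<xi>. \<xi> \<in> ?F \<Longrightarrow> fefferman_density m \<xi> \<le> B" using fefferman_density_bounded[OF assms] by blast
  have space: "space (sigma_E m) = ?F" using space_sigma_F[of m] by (simp add: sigma_F_def)
  have sets: "?F \<in> sets (sigma_E m)" using sets.top[of "sigma_E m"] space by simp
  have "interior (dom2m m) \<noteq> {}"
    using zero_in_dom2m[OF assms] by (auto simp: interior_open open_dom2m)
  then have "hausdorff_outer 3 ?F < \<infinity>"
    using convex_dom2m bounded_dom2m[OF assms] by (intro hausdorff_outer_frontier_convex_finite) auto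
  then have fin: "emeasure (hausdorff_measure 3) ?F < \<infinity>"
    by (rule le_less_trans[OF emeasure_hausdorff_measure_le])
  have "emeasure (sigma_F m) ?F = (\<integral>\<^sup>+ \<xi>. ennreal (fefferman_density m \<xi>) * indicator ?F \<xi> \<partial>sigma_E m)"
    unfolding sigma_F_def using B(1) sets by (intro emeasure_density) auto
  also have "\<dots> \<le> (\<integral>\<^sup>+ \<xi>. ennreal B \<partial>sigma_E m)"
    using B(2) by (intro nn_integral_mono) (auto simp: space intro: ennreal_leI)
  also have "\<dots> = ennreal B * emeasure (hausdorff_measure 3) ?F"
    unfolding sigma_E_def
    by (simp add: space_restrict_space space_hausdorff_measure emeasure_restrict_space sets_hausdorff_measure)
  also have "\<dots> < \<infinity>" using fin by (simp add: ennreal_mult_less_top)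
  finally show ?thesis by (simp add: space_sigma_F)
qed

subsection \<open>Dilations and boundary values\<close>

lemma nt_maximal_ge:
  "p \<in> approach_region m \<alpha> \<xi> \<Longrightarrow> ennreal (cmod (f p)) \<le> nt_maximal m \<alpha> f \<xi>"
  unfolding nt_maximal_def by (rule SUP_upper)

lemma holomorphic2_on_imp_isCont: "f holomorphic2_on U \<Longrightarrow> p \<in> U \<Longrightarrow> isCont f p"
  unfolding holomorphic2_on_def by (meson has_derivative_continuous)

lemma holomorphic_near_isCont: "g \<in> holomorphic_near K \<Longrightarrow> p \<in> K \<Longrightarrow> isCont g p"
  unfolding holomorphic_near_def using holomorphic2_on_imp_isCont by blast

lemma holomorphic_near_subset_fefferman_hardy:
  assumes "m > 0"
  shows "holomorphic_near (closure (dom2m m)) \<subseteq> fefferman_hardy m \<alpha>"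
proof
  fix g assume g: "g \<in> holomorphic_near (closure (dom2m m))"
  have "g holomorphic2_on dom2m m"
    using g closure_subset[of "dom2m m"] unfolding holomorphic_near_def holomorphic2_on_def by blast
  moreover have "(\<integral>\<^sup>+ \<xi>. (nt_maximal m \<alpha> g \<xi>)\<^sup>2 \<partial>sigma_F m) < \<infinity>"
  proof -
    have "compact (closure (dom2m m))" using bounded_dom2m[OF assms] by simp
    moreover have "continuous_on (closure (dom2m m)) g"
      using holomorphic_near_isCont[OF g] by (rule continuous_at_imp_continuous_on[rule_format])
    ultimately have "bounded (g ` closure (dom2m m))"
      using compact_continuous_image compact_imp_bounded by blast
    then obtain B where B: "\<And>p. p \<in> closure (dom2m m) \<Longrightarrow> cmod (g p) \<le> B"
      by (auto simp: bounded_iff)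
    have "nt_maximal m \<alpha> g \<xi> \<le> ennreal B" for \<xi>
      unfolding nt_maximal_def approach_region_def
      using B closure_subset[of "dom2m m"] by (intro SUP_least ennreal_leI) blast
    then have "(\<integral>\<^sup>+ \<xi>. (nt_maximal m \<alpha> g \<xi>)\<^sup>2 \<partial>sigma_F m) \<le> (\<integral>\<^sup>+ \<xi>. (ennreal B)\<^sup>2 \<partial>sigma_F m)"
      by (intro nn_integral_mono power_mono) auto
    also have "\<dots> = (ennreal B)\<^sup>2 * emeasure (sigma_F m) (space (sigma_F m))" by simp
    also have "\<dots> < \<infinity>"
      using emeasure_sigma_F_finite[OF assms] by (simp add: ennreal_mult_less_top power2_eq_square)
    finally show ?thesis .
  qed
  ultimately show "g \<in> fefferman_hardy m \<alpha>"
    using borel_measurable_nt_maximal[OF assms] by (simp add: fefferman_hardy_def)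
qed

lemma dilation_holomorphic_near:
  assumes "m > 0" "f holomorphic2_on dom2m m" "0 \<le> r" "r < 1"
  shows "(\<lambda>p. f (r *\<^sub>R p)) \<in> holomorphic_near (closure (dom2m m))"
proof -
  \<comment> \<open>\<open>f\<close> is controlled only on the domain, so the neighbourhood is the
    preimage of the domain under the dilation; \<open>rho_scaleR_neg\<close> places the closure
    inside it.\<close>
  let ?U = "(\<lambda>p. r *\<^sub>R p) -` dom2m m"
  have "open ?U" by (intro open_vimage open_dom2m continuous_intros)
  moreover have "closure (dom2m m) \<subseteq> ?U"
    using closure_dom2m_subset[of m] rho_scaleR_neg[OF assms(1) _ assms(3,4)]
    by (auto simp: dom2m_altdef)
  moreover have "(\<lambda>p. f (r *\<^sub>R p)) holomorphic2_on ?U"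
    unfolding holomorphic2_on_def
  proof
    fix p assume "p \<in> ?U"
    then have "r *\<^sub>R p \<in> dom2m m" by simp
    then obtain a b where d: "(f has_derivative (\<lambda>(h, k). a * h + b * k)) (at (r *\<^sub>R p))"
      using assms(2) unfolding holomorphic2_on_def by blast
    have "((\<lambda>p. f (r *\<^sub>R p)) has_derivative (\<lambda>v. (\<lambda>(h, k). a * h + b * k) (r *\<^sub>R v))) (at p)"
      by (rule has_derivative_compose[OF has_derivative_scaleR_right[OF has_derivative_ident] d])
    moreover have "(\<lambda>v. (\<lambda>(h, k). a * h + b * k) (r *\<^sub>R v)) = (\<lambda>(h, k). (of_real r * a) * h + (of_real r * b) * k)"
      by (auto simp: fun_eq_iff scaleR_conv_of_real)
    ultimately show "\<exists>a b. ((\<lambda>p. f (r *\<^sub>R p)) has_derivative (\<lambda>(h, k). a * h + b * k)) (at p)" by metis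
  qed
  ultimately show ?thesis unfolding holomorphic_near_def by blast
qed

lemma radial_limit:
  assumes "m > 0" "\<xi> \<in> frontier (dom2m m)" "has_nt_limit m f l \<xi>"
  shows "((\<lambda>r. f (r *\<^sub>R \<xi>)) \<longlongrightarrow> l) (at_left (1::real))"
proof -
  obtain r0 where r0: "r0 < 1" "\<And>r. r0 < r \<Longrightarrow> r < 1 \<Longrightarrow> r *\<^sub>R \<xi> \<in> approach_region m 1 \<xi>"
    using radius_in_approach_region[OF assms(1), of 1] assms(2) by (metis zero_less_one)
  \<comment> \<open>The punctured filter at \<xi> excludes \<xi> itself, and \<open>r \<xi>\<close>
    differs from \<xi> only because \<xi> is nonzero.\<close>
  have "\<xi> \<noteq> 0" using rho_frontier[OF assms(2)] zero_in_dom2m[OF assms(1)] by (auto simp: dom2m_altdef)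
  then have "r *\<^sub>R \<xi> \<in> approach_region m 1 \<xi> \<and> r *\<^sub>R \<xi> \<noteq> \<xi>" if "r \<in> {r0<..<1}" for r
    using r0(2)[of r] that by (auto dest!: scaleR_right_imp_eq[of \<xi> r 1, simplified])
  then have "\<forall>\<^sub>F r in at_left 1. r *\<^sub>R \<xi> \<in> approach_region m 1 \<xi> \<and> r *\<^sub>R \<xi> \<noteq> \<xi>"
    using eventually_at_left_real[OF r0(1)] by (rule eventually_mono[rotated])
  moreover have "((\<lambda>r. r *\<^sub>R \<xi>) \<longlongrightarrow> 1 *\<^sub>R \<xi>) (at_left (1::real))" by (intro tendsto_intros)
  ultimately have "filterlim (\<lambda>r. r *\<^sub>R \<xi>) (at \<xi> within approach_region m 1 \<xi>) (at_left 1)"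
    by (simp add: filterlim_at)
  moreover have "(f \<longlongrightarrow> l) (at \<xi> within approach_region m 1 \<xi>)"
    using assms(3) by (simp add: has_nt_limit_def)
  ultimately show ?thesis by (rule filterlim_compose[rotated])
qed

text \<open>Uniqueness of the limit requires \<xi> to be an accumulation point of the approach
  regions; the radius ending at \<xi> provides this.\<close>

lemma boundary_value_eqI:
  assumes "m > 0" "\<xi> \<in> frontier (dom2m m)" "has_nt_limit m f l \<xi>"
  shows "boundary_value m f \<xi> = l"
proof -
  have "l' = l" if "has_nt_limit m f l' \<xi>" for l'
    using radial_limit[OF assms(1,2) that] radial_limit[OF assms]
    by (rule tendsto_unique[OF trivial_limit_at_left_real])
  then have "(THE l. has_nt_limit m f l \<xi>) = l" using assms(3) by (intro the_equality)
  then show ?thesis using assms(3) by (auto simp: boundary_value_def)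
qed

text \<open>Subtracting a function continuous at \<xi> neither creates nor destroys a non-tangential
  limit, so the default value is taken at the same points for \<open>f\<close> and for the
  difference.\<close>

lemma boundary_value_diff:
  assumes "m > 0" "\<xi> \<in> frontier (dom2m m)" "isCont g \<xi>"
  shows "boundary_value m (\<lambda>p. f p - g p) \<xi> =
     (if \<exists>l. has_nt_limit m f l \<xi> then boundary_value m f \<xi> - g \<xi> else 0)"
proof -
  have g: "(g \<longlongrightarrow> g \<xi>) (at \<xi> within S)" for S
    using assms(3) unfolding isCont_def by (rule tendsto_within_subset) simp
  have diff: "has_nt_limit m (\<lambda>p. f p - g p) (l - g \<xi>) \<xi>" if "has_nt_limit m f l \<xi>" for l
    using that g by (auto simp: has_nt_limit_def intro: tendsto_diff)
  have add: "has_nt_limit m f (l + g \<xi>) \<xi>" if "has_nt_limit m (\<lambda>p. f p - g p) l \<xi>" for l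
    unfolding has_nt_limit_def
  proof (intro allI impI)
    fix \<alpha> :: real assume "\<alpha> > 0"
    then have "((\<lambda>p. f p - g p) \<longlongrightarrow> l) (at \<xi> within approach_region m \<alpha> \<xi>)"
      using that by (simp add: has_nt_limit_def)
    from tendsto_add[OF this g] show "(f \<longlongrightarrow> l + g \<xi>) (at \<xi> within approach_region m \<alpha> \<xi>)" by simp
  qed
  note eq = boundary_value_eqI[OF assms(1,2)]
  show ?thesis
  proof (cases "\<exists>l. has_nt_limit m f l \<xi>")
    case True
    then obtain l where l: "has_nt_limit m f l \<xi>" ..
    show ?thesis
      using True eq[OF l] eq[OF diff[OF l]] by simp
  next
    case False
    then have "\<not> (\<exists>l. has_nt_limit m (\<lambda>p. f p - g p) l \<xi>)" using add by blast
    then show ?thesis using False by (simp add: boundary_value_def)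
  qed
qed

section \<open>Convergence of the dilations in norm\<close>

text \<open>The argument by contradiction supplies measurability of the boundary values: norms
  bounded below by \<epsilon> force every \<open>s n\<close> to be integrable, as dominated
  convergence demands.\<close>

lemma fefferman_hardy_approx:
  assumes "m > 0" "\<alpha> > 0" and f: "f \<in> fefferman_hardy m \<alpha>" and "\<epsilon> > 0"
  shows "\<exists>g \<in> holomorphic_near (closure (dom2m m)). fh_norm m (\<lambda>p. f p - g p) < \<epsilon>"
proof (rule ccontr)
  assume neg: "\<not> ?thesis"
  let ?F = "frontier (dom2m m)"
  define N where "N = nt_maximal m \<alpha> f"
  obtain r0 where r0: "0 \<le> r0" "r0 < 1"
    and rad: "\<And>\<xi> r. \<xi> \<in> ?F \<Longrightarrow> r0 < r \<Longrightarrow> r < 1 \<Longrightarrow> r *\<^sub>R \<xi> \<in> approach_region m \<alpha> \<xi>"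
    using radius_in_approach_region[OF assms(1,2)] by metis
  \<comment> \<open>The shift by 2 makes \<open>r0 < r n\<close> strict already at
    \<open>n = 0\<close>.\<close>
  define r where "r n = 1 - (1 - r0) / real (n + 2)" for n :: nat
  have r: "r0 < r n" "r n < 1" for n
  proof -
    have "(1 - r0) / real (n + 2) < (1 - r0) / 1"
      using r0 by (intro divide_strict_left_mono) auto
    moreover have "0 < (1 - r0) / real (n + 2)" using r0 by simp
    ultimately show "r0 < r n" "r n < 1" by (simp_all add: r_def)
  qed
  have "r \<longlonglongrightarrow> 1 - 0"
    unfolding r_def by (intro tendsto_diff tendsto_const LIMSEQ_ignore_initial_segment[OF lim_const_over_n])
  then have r_left: "filterlim r (at_left 1) sequentially"
    using r(2) by (auto simp: filterlim_at intro!: always_eventually simp: less_imp_neq)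
  define g where "g n p = f (r n *\<^sub>R p)" for n p
  have hol: "f holomorphic2_on dom2m m" and N_meas [measurable]: "N \<in> borel_measurable (sigma_F m)"
    and N_fin: "(\<integral>\<^sup>+ \<xi>. (N \<xi>)\<^sup>2 \<partial>sigma_F m) < \<infinity>"
    using f by (auto simp: fefferman_hardy_def N_def)
  have g: "g n \<in> holomorphic_near (closure (dom2m m))" for n
    unfolding g_def using dilation_holomorphic_near[OF assms(1) hol] r(1)[of n] r(2)[of n] r0(1) by simp
  define s where "s n \<xi> = (cmod (boundary_value m (\<lambda>p. f p - g n p) \<xi>))\<^sup>2" for n \<xi>
  have norm_eq: "fh_norm m (\<lambda>p. f p - g n p) = sqrt (\<integral>\<xi>. s n \<xi> \<partial>sigma_F m)" for n
    by (simp add: fh_norm_def s_def)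
  have large: "\<epsilon> \<le> sqrt (\<integral>\<xi>. s n \<xi> \<partial>sigma_F m)" for n
    using neg g[of n] norm_eq[of n] by (auto simp: not_less)
  \<comment> \<open>The Bochner integral of a non-integrable function is \<open>0\<close>, which would contradict \<open>large\<close>.\<close>
  have s_int: "integrable (sigma_F m) (s n)" for n
  proof (rule ccontr)
    assume "\<not> integrable (sigma_F m) (s n)"
    then show False using large[of n] \<open>\<epsilon> > 0\<close> by (simp add: not_integrable_integral_eq)
  qed
  have bv: "boundary_value m (\<lambda>p. f p - g n p) \<xi> =
      (if \<exists>l. has_nt_limit m f l \<xi> then boundary_value m f \<xi> - f (r n *\<^sub>R \<xi>) else 0)" if "\<xi> \<in> ?F" for n \<xi>
    using boundary_value_diff[OF assms(1) that, of "g n" f] holomorphic_near_isCont[OF g, of \<xi> n] that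
    by (simp add: g_def frontier_def)
  \<comment> \<open>Where \<open>f\<close> has no limit, neither has \<open>f - g n\<close>, and \<open>boundary_value\<close> is the junk value \<open>0\<close>,
    so no Fatou theorem is needed.\<close>
  have lim: "(\<lambda>n. s n \<xi>) \<longlonglongrightarrow> 0" if \<xi>: "\<xi> \<in> ?F" for \<xi>
  proof (cases "\<exists>l. has_nt_limit m f l \<xi>")
    case True
    then obtain l where l: "has_nt_limit m f l \<xi>" ..
    have "(\<lambda>n. f (r n *\<^sub>R \<xi>)) \<longlonglongrightarrow> l"
      by (rule filterlim_compose[OF radial_limit[OF assms(1) \<xi> l] r_left])
    then have "(\<lambda>n. (cmod (l - f (r n *\<^sub>R \<xi>)))\<^sup>2) \<longlonglongrightarrow> (cmod (l - l))\<^sup>2" by (intro tendsto_intros)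
    then show ?thesis
      using True boundary_value_eqI[OF assms(1) \<xi> l] by (simp add: s_def bv[OF \<xi>])
  qed (simp add: s_def bv[OF \<xi>])
  \<comment> \<open>Both the limit \<open>l\<close> and \<open>f (r n \<xi>)\<close> are bounded by
    the maximal function, \<open>l\<close> as a limit along the radius. Finiteness matters because
    \<open>enn2real\<close> sends infinity to 0.\<close>
  have bound: "norm (s n \<xi>) \<le> (2 * enn2real (N \<xi>))\<^sup>2" if \<xi>: "\<xi> \<in> ?F" and fin: "N \<xi> \<noteq> \<infinity>" for n \<xi>
  proof (cases "\<exists>l. has_nt_limit m f l \<xi>")
    case True
    then obtain l where l: "has_nt_limit m f l \<xi>" ..
    have le: "cmod (f (t *\<^sub>R \<xi>)) \<le> enn2real (N \<xi>)" if "r0 < t" "t < 1" for t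
    proof -
      have "ennreal (cmod (f (t *\<^sub>R \<xi>))) \<le> N \<xi>"
        unfolding N_def by (rule nt_maximal_ge[OF rad[OF \<xi> that]])
      then have "enn2real (ennreal (cmod (f (t *\<^sub>R \<xi>)))) \<le> enn2real (N \<xi>)"
        using fin by (intro enn2real_mono) (auto simp: top.not_eq_extremum)
      then show ?thesis by simp
    qed
    have "((\<lambda>t. cmod (f (t *\<^sub>R \<xi>))) \<longlongrightarrow> cmod l) (at_left 1)"
      using radial_limit[OF assms(1) \<xi> l] by (rule tendsto_norm)
    moreover have "\<forall>\<^sub>F t in at_left 1. cmod (f (t *\<^sub>R \<xi>)) \<le> enn2real (N \<xi>)"
      using eventually_at_left_real[OF r0(2)] by (rule eventually_mono) (use le in auto)
    ultimately have "cmod l \<le> enn2real (N \<xi>)"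
      using trivial_limit_at_left_real by (rule tendsto_upperbound)
    then have "cmod (l - f (r n *\<^sub>R \<xi>)) \<le> 2 * enn2real (N \<xi>)"
      using norm_triangle_ineq4[of l "f (r n *\<^sub>R \<xi>)"] le[OF r(1) r(2), of n] by linarith
    then have "(cmod (l - f (r n *\<^sub>R \<xi>)))\<^sup>2 \<le> (2 * enn2real (N \<xi>))\<^sup>2" by (rule power_mono) simp
    then show ?thesis
      using True boundary_value_eqI[OF assms(1) \<xi> l] by (simp add: s_def bv[OF \<xi>])
  qed (simp add: s_def bv[OF \<xi>])
  have "AE \<xi> in sigma_F m. (N \<xi>)\<^sup>2 \<noteq> \<infinity>" using N_fin by (intro nn_integral_PInf_AE) auto
  then have N_AE: "AE \<xi> in sigma_F m. \<xi> \<in> ?F \<and> N \<xi> \<noteq> \<infinity>"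
    using AE_space[of "sigma_F m"] by eventually_elim (auto simp: space_sigma_F)
  have "(\<lambda>n. \<integral>\<xi>. s n \<xi> \<partial>sigma_F m) \<longlonglongrightarrow> (\<integral>\<xi>. 0 \<partial>sigma_F m)"
  proof (rule integral_dominated_convergence)
    \<comment> \<open>For infinite \<open>x\<close> the left side is 0, so the inequality holds
      without exception.\<close>
    have sq: "ennreal ((2 * enn2real x)\<^sup>2) \<le> 4 * x\<^sup>2" for x
      by (cases x) (auto simp: ennreal_power[symmetric] power_mult_distrib ennreal_mult)
    have "(\<integral>\<^sup>+ \<xi>. ennreal (norm ((2 * enn2real (N \<xi>))\<^sup>2)) \<partial>sigma_F m) \<le> (\<integral>\<^sup>+ \<xi>. 4 * (N \<xi>)\<^sup>2 \<partial>sigma_F m)"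
      using sq by (intro nn_integral_mono) simp
    also have "\<dots> < \<infinity>" using N_fin by (simp add: nn_integral_cmult ennreal_mult_less_top)
    finally show "integrable (sigma_F m) (\<lambda>\<xi>. (2 * enn2real (N \<xi>))\<^sup>2)"
      by (intro integrableI_bounded) measurable
    show "AE \<xi> in sigma_F m. (\<lambda>n. s n \<xi>) \<longlonglongrightarrow> 0" using N_AE by eventually_elim (use lim in auto)
    show "AE \<xi> in sigma_F m. norm (s n \<xi>) \<le> (2 * enn2real (N \<xi>))\<^sup>2" for n
      using N_AE by eventually_elim (use bound in auto)
  qed (use s_int in auto)
  then have "(\<lambda>n. sqrt (\<integral>\<xi>. s n \<xi> \<partial>sigma_F m)) \<longlonglongrightarrow> sqrt 0" by (intro tendsto_real_sqrt) simp
  then have "\<epsilon> \<le> sqrt 0" using large by (intro tendsto_lowerbound) auto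
  then show False using \<open>\<epsilon> > 0\<close> by simp
qed

theorem corollary3p8:
  fixes m :: nat and \<alpha> :: real
  assumes "m > 0" and "\<alpha> > 0"
  shows "holomorphic_near (closure (dom2m m)) \<subseteq> fefferman_hardy m \<alpha> \<and>
         (\<forall>f \<in> fefferman_hardy m \<alpha>. \<forall>\<epsilon>>0. \<exists>g \<in> holomorphic_near (closure (dom2m m)).
            fh_norm m (\<lambda>p. f p - g p) < \<epsilon>)"
  using holomorphic_near_subset_fefferman_hardy[OF assms(1)] fefferman_hardy_approx[OF assms] by blast

end
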